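(* Let $\theta_*=(\alpha_*,\mu_*,\sigma_* )\in\Theta$, let $Y_n=q(X_n)$, $n\ge 0$, be the rounded-off observations of the stable Gaussian AR(1) process $X_n$ with parameter $\theta_*$, and let $\tilde\theta_n$, $n\in\mathbb{N}$, be any sequence of $\Theta$-valued random variables such that $\tilde\theta_n\in\mathrm{argmax}_{\theta\in\Theta}L_n(\theta;Y_0,\ldots,Y_n)$ for every $n$ (maximum likelihood estimators). Then $\tilde\theta_n\to\theta_*$ almost surely as $n\to\infty$.
   Context: All random variables live on a fixed probability space $(\Omega,\mathcal{F},P)$. The rounding-off function $q:\mathbb{R}\to\mathbb{Z}$ is $q(x)=k$ for $x\in[k-1/2,k+1/2)$, $k\in\mathbb{Z}$. The parameter set is $\Theta:=[\underline{\alpha},\overline{\alpha}]\times[\underline{\mu},\overline{\mu}]\times[\underline{\sigma},\overline{\sigma}]$, where $[\underline{\alpha},\overline{\alpha}]\subset[0,1)$, $[\underline{\mu},\overline{\mu}]\subset\mathbb{R}$, $[\underline{\sigma},\overline{\sigma}]\subset(0,\infty)$ are compact intervals. The true process is given by $X_{-1}=0$ and $X_n=\alpha_*X_{n-1}+\varepsilon_n$ for $n\ge0$, where $\varepsilon_n$, $n\ge 0$, are i.i.d. with law $N(\mu_*,\sigma_*^2)$. For each $\theta=(\alpha,\mu,\sigma)\in\Theta$, define $X^{(\theta)}_{-1}:=0$ and $X^{(\theta)}_n=\alpha X^{(\theta)}_{n-1}+\varepsilon^{(\theta)}_n$ for $n\ge0$, where $\varepsilon^{(\theta)}_n$, $n\ge0$,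 are i.i.d. with law $N(\mu,\sigma^2)$, and set $Y^{(\theta)}_n:=q(X^{(\theta)}_n)$. The loglikelihood functions are $L_n(\theta;y_0,\ldots,y_n):=\ln P(Y^{(\theta)}_0=y_0,\ldots,Y^{(\theta)}_n=y_n)$ for $y_0,\ldots,y_n\in\mathbb{Z}$ and $\theta\in\Theta$. *)

theory Defs
  imports "HOL-Probability.Probability"
begin

definition rounding_off :: "real \<Rightarrow> int" where
  "rounding_off x = (THE k. x \<in> {real_of_int k - 1/2 ..< real_of_int k + 1/2})"

lemma rounding_off_eq_iff:
  "rounding_off x = k \<longleftrightarrow> x \<in> {real_of_int k - 1/2 ..< real_of_int k + 1/2}"
proof -
  have char: "x \<in> {real_of_int j - 1/2 ..< real_of_int j + 1/2} \<longleftrightarrow> j = round x" for j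
    unfolding round_def by (auto simp: floor_eq_iff eq_commute[of j])
  show ?thesis
    unfolding rounding_off_def char by auto
qed

lemma rounding_off_eq_round: "rounding_off x = round x"
  by (subst rounding_off_eq_iff) (simp add: round_def, linarith)

text \<open>The parameter \<open>(\<alpha>, \<mu>, \<sigma>)\<close>.\<close>

type_synonym param = "real \<times> real \<times> real"

text \<open>The AR(1) recursion with initial value \<open>X\<^sub>-\<^sub>1 = 0\<close>; the natural-number index starts at
  \<open>X\<^sub>0 = \<alpha> * X\<^sub>-\<^sub>1 + \<epsilon>\<^sub>0 = \<epsilon>\<^sub>0\<close>.\<close>

primrec ar1 :: "real \<Rightarrow> (nat \<Rightarrow> 'a \<Rightarrow> real) \<Rightarrow> nat \<Rightarrow> 'a \<Rightarrow> real" where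
  "ar1 \<alpha> \<epsilon> 0 \<omega> = \<alpha> * 0 + \<epsilon> 0 \<omega>"
| "ar1 \<alpha> \<epsilon> (Suc n) \<omega> = \<alpha> * ar1 \<alpha> \<epsilon> n \<omega> + \<epsilon> (Suc n) \<omega>"

definition rounded_ar1 :: "real \<Rightarrow> (nat \<Rightarrow> 'a \<Rightarrow> real) \<Rightarrow> nat \<Rightarrow> 'a \<Rightarrow> int" where
  "rounded_ar1 \<alpha> \<epsilon> n \<omega> = rounding_off (ar1 \<alpha> \<epsilon> n \<omega>)"

text \<open>The third argument is the standard deviation, not the variance.\<close>

definition iid_normal :: "'a measure \<Rightarrow> real \<Rightarrow> real \<Rightarrow> (nat \<Rightarrow> 'a \<Rightarrow> real) \<Rightarrow> bool" where
  "iid_normal M \<mu> \<sigma> \<epsilon> \<longleftrightarrow>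
     prob_space.indep_vars M (\<lambda>_. borel) \<epsilon> UNIV \<and>
     (\<forall>n. distributed M lborel (\<epsilon> n) (\<lambda>x. ennreal (normal_density \<mu> \<sigma> x)))"

text \<open>\<open>E \<theta>\<close> is the noise sequence \<open>\<epsilon>\<^sup>(\<^sup>\<theta>\<^sup>)\<close> driving the model with parameter \<open>\<theta>\<close>. Only
  \<open>y 0, \<dots>, y n\<close> matter.
  For Gaussian noise with \<open>\<sigma> > 0\<close> the probability below is positive, so the convention
  \<open>ln 0 = 0\<close> plays no role.\<close>

definition log_likelihood ::
    "'a measure \<Rightarrow> (param \<Rightarrow> nat \<Rightarrow> 'a \<Rightarrow> real) \<Rightarrow> nat \<Rightarrow> param \<Rightarrow> (nat \<Rightarrow> int) \<Rightarrow> real" where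
  "log_likelihood M E n \<theta> y =
     ln (measure M {\<omega> \<in> space M. \<forall>i\<le>n. rounded_ar1 (fst \<theta>) (E \<theta>) i \<omega> = y i})"

end

theory Submission
  imports Defs
begin

text \<open>
  A maximum likelihood estimate stays away from a parameter \<open>\<theta> \<noteq> \<theta>\<^sub>*\<close> because, along the true path,
  the likelihood \<open>p\<^sub>\<theta>\<close> is exponentially smaller than \<open>p\<^sub>*\<close>, the likelihood of \<open>\<theta>\<^sub>*\<close>, with a
  margin that survives a small change of \<open>\<theta>\<close>.

  The margin comes from testing. Let \<open>A\<close> be an event about the first observations. Those data
  sequences in \<open>A\<close> for which \<open>p\<^sub>* \<le> e\<^bsup>\<eta>n\<^esup> p\<^sub>\<theta>\<close> have true probability at most
  \<open>e\<^bsup>\<eta>n\<^esup> P\<^sub>\<theta>(A)\<close>, as one sees by summing over these countably many sequences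
  (\<open>likelihood_ratio_change_of_measure\<close>). So it suffices to have events \<open>A\<^sub>n\<close> that almost surely hold
  eventually for the true process while \<open>P\<^sub>\<theta>(A\<^sub>n)\<close> decays like \<open>e\<^bsup>-cn\<^esup>\<close>; then \<open>\<eta> = c/2\<close> and the
  Borel--Cantelli lemma give \<open>p\<^sub>\<theta> < e\<^bsup>-\<eta>n\<^esup> p\<^sub>*\<close> eventually (\<open>likelihood_separation\<close>).
  The event \<open>A\<^sub>n\<close> says that the average of a bounded statistic of two consecutive roundings exceeds
  the midpoint of its stationary means under \<open>\<theta>\<close> and \<open>\<theta>\<^sub>*\<close>. Two ingredients make this work: bounded
  statistics of consecutive states concentrate exponentially fast around their stationary mean
  (\<open>additive_functional_concentration\<close>), and some statistic has different stationary means under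
  \<open>\<theta>\<close> and \<open>\<theta>\<^sub>*\<close> (\<open>rounded_pair_statistic_separates\<close>). For the latter, the probabilities of
  \<open>X < 1/2\<close> and \<open>X < 3/2\<close> determine the stationary mean and standard deviation, and then the
  probability that two consecutive states are both below \<open>1/2\<close> determines \<open>\<alpha>\<close>.

  The stability in \<open>\<theta>\<close> is deterministic. The logarithm of the transition density is a quadratic
  polynomial in the two states whose coefficients are continuous in \<open>\<theta>\<close>, and the states differ from
  the observations \<open>y\<^sub>i\<close> by at most \<open>1/2\<close>. Hence replacing \<open>\<theta>\<close> by a nearby \<open>\<theta>'\<close> multiplies the
  likelihood by at most \<open>exp (d \<Sum>\<^sub>i (2 + 2 y\<^sub>i\<^sub>-\<^sub>1\<^sup>2 + 2 y\<^sub>i\<^sup>2))\<close> with \<open>d\<close> small (\<open>rounded_prob_ratio\<close>), and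
  this sum grows linearly in \<open>n\<close> almost surely (\<open>rounded_squares_linear_growth\<close>). Together: every
  \<open>\<theta> \<noteq> \<theta>\<^sub>*\<close> has a ball on which the likelihood is eventually below that of \<open>\<theta>\<^sub>*\<close>
  (\<open>likelihood_locally_dominated\<close>), and compactness of the parameter set finishes the proof.
\<close>

section \<open>Gaussian laws on the real line\<close>

definition gauss :: "real \<Rightarrow> real \<Rightarrow> real measure" where
  "gauss \<mu> \<sigma> = density lborel (\<lambda>x. ennreal (normal_density \<mu> \<sigma> x))"

lemma space_gauss [simp]: "space (gauss \<mu> \<sigma>) = UNIV"
  by (simp add: gauss_def)

lemma sets_gauss [simp, measurable_cong]: "sets (gauss \<mu> \<sigma>) = sets borel"
  by (simp add: gauss_def)

lemma prob_space_gauss: "0 < \<sigma> \<Longrightarrow> prob_space (gauss \<mu> \<sigma>)"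
  unfolding gauss_def by (rule prob_space_normal_density)

lemma integral_gauss:
  assumes [measurable]: "f \<in> borel_measurable borel"
  shows "(\<integral>x. f x \<partial>gauss \<mu> \<sigma>) = (\<integral>x. normal_density \<mu> \<sigma> x * (f x :: real) \<partial>lborel)"
  unfolding gauss_def by (subst integral_density) auto

lemma distributed_gauss:
  "distributed M lborel X (\<lambda>x. ennreal (normal_density \<mu> \<sigma> x)) \<longleftrightarrow>
     X \<in> borel_measurable M \<and> distr M borel X = gauss \<mu> \<sigma>"
proof -
  have "distr M lborel X = distr M borel X"
    by (rule distr_cong) auto
  then show ?thesis
    by (auto simp: distributed_def gauss_def)
qed

text \<open>With \<open>b = 1 / (8 \<sigma>\<^sup>2)\<close> the product of the density and \<open>e\<^bsup>bx\<^sup>2\<^esup>\<close> is still dominated by a multiple of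
  a normal density, of standard deviation \<open>2 \<sigma>\<close>.\<close>

lemma integrable_gauss_exp_square:
  assumes "0 < \<sigma>"
  obtains b where "0 < b" "integrable (gauss \<mu> \<sigma>) (\<lambda>x. exp (b * x\<^sup>2))"
proof
  define b where "b = 1 / (8 * \<sigma>\<^sup>2)"
  show "0 < b" using assms by (simp add: b_def)
  have bound: "normal_density \<mu> \<sigma> x * exp (b * x\<^sup>2) \<le> 2 * exp (2 * b * \<mu>\<^sup>2) * normal_density \<mu> (2 * \<sigma>) x" for x
  proof -
    have "b * x\<^sup>2 \<le> b * (2 * (x - \<mu>)\<^sup>2 + 2 * \<mu>\<^sup>2)"
      using \<open>0 < b\<close> sum_squares_ge_zero[of "x - 2 * \<mu>" 0]
      by (intro mult_left_mono) (auto simp: power2_eq_square algebra_simps)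
    also have "\<dots> = (x - \<mu>)\<^sup>2 / (4 * \<sigma>\<^sup>2) + 2 * b * \<mu>\<^sup>2"
      using assms by (simp add: b_def field_simps)
    finally have "- (x - \<mu>)\<^sup>2 / (2 * \<sigma>\<^sup>2) + b * x\<^sup>2 \<le> - (x - \<mu>)\<^sup>2 / (4 * \<sigma>\<^sup>2) + 2 * b * \<mu>\<^sup>2"
      by (simp add: field_simps)
    also have "\<dots> \<le> - (x - \<mu>)\<^sup>2 / (2 * (2 * \<sigma>)\<^sup>2) + 2 * b * \<mu>\<^sup>2"
      using assms by (simp add: field_simps)
    finally have "exp (- (x - \<mu>)\<^sup>2 / (2 * \<sigma>\<^sup>2)) * exp (b * x\<^sup>2) \<le> exp (- (x - \<mu>)\<^sup>2 / (2 * (2 * \<sigma>)\<^sup>2)) * exp (2 * b * \<mu>\<^sup>2)"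
      by (simp flip: exp_add)
    moreover have "sqrt (2 * pi * (2 * \<sigma>)\<^sup>2) = sqrt (2\<^sup>2 * (2 * pi * \<sigma>\<^sup>2))"
      by (simp add: power_mult_distrib)
    then have "sqrt (2 * pi * (2 * \<sigma>)\<^sup>2) = 2 * sqrt (2 * pi * \<sigma>\<^sup>2)"
      by (simp only: real_sqrt_mult real_sqrt_abs abs_numeral)
    ultimately show ?thesis
      using assms by (simp add: normal_density_def field_simps)
  qed
  have "integrable lborel (\<lambda>x. normal_density \<mu> \<sigma> x * exp (b * x\<^sup>2))"
    by (rule Bochner_Integration.integrable_bound
        [where f = "\<lambda>x. 2 * exp (2 * b * \<mu>\<^sup>2) * normal_density \<mu> (2 * \<sigma>) x"])
       (use assms bound in \<open>auto simp: abs_mult\<close>)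
  then show "integrable (gauss \<mu> \<sigma>) (\<lambda>x. exp (b * x\<^sup>2))"
    unfolding gauss_def by (subst integrable_density) auto
qed

lemma integrable_gauss_exp_abs:
  assumes "0 < \<sigma>"
  shows "integrable (gauss \<mu> \<sigma>) (\<lambda>x. exp (c * \<bar>x\<bar>))"
proof -
  obtain b where b: "0 < b" "integrable (gauss \<mu> \<sigma>) (\<lambda>x. exp (b * x\<^sup>2))"
    using integrable_gauss_exp_square[OF assms] .
  have "c * \<bar>x\<bar> \<le> b * x\<^sup>2 + c\<^sup>2 / (4 * b)" for x
  proof -
    have "0 \<le> (2 * b * \<bar>x\<bar> - c)\<^sup>2" by simp
    also have "\<dots> = 4 * b * (b * x\<^sup>2 + c\<^sup>2 / (4 * b) - c * \<bar>x\<bar>)"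
      using b(1) by (simp add: power2_eq_square algebra_simps)
    finally show ?thesis
      using b(1) by (simp add: zero_le_mult_iff)
  qed
  then have "exp (c * \<bar>x\<bar>) \<le> exp (c\<^sup>2 / (4 * b)) * exp (b * x\<^sup>2)" for x
    by (simp flip: exp_add add: add.commute)
  then show ?thesis
    by (intro Bochner_Integration.integrable_bound
        [OF integrable_mult_right[OF b(2), of "exp (c\<^sup>2 / (4 * b))"]]) auto
qed

lemma integrable_gauss_abs:
  assumes "0 < \<sigma>"
  shows "integrable (gauss \<mu> \<sigma>) (\<lambda>x. \<bar>x\<bar>)"
proof (rule Bochner_Integration.integrable_bound[OF integrable_gauss_exp_abs[OF assms, of \<mu> 1]])
  show "AE x in gauss \<mu> \<sigma>. norm \<bar>x\<bar> \<le> norm (exp (1 * \<bar>x\<bar>))"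
    using exp_ge_add_one_self by (intro AE_I2) (smt (verit) real_norm_def)
qed auto

lemma le_exp_self: "x \<le> exp (x::real)"
  using exp_ge_add_one_self[of x] by linarith

lemma exp_minus_one_abs_le:
  fixes u w a :: real
  assumes "\<bar>u\<bar> \<le> \<bar>a\<bar> * w" "\<bar>a\<bar> \<le> 1" "0 \<le> w"
  shows "\<bar>exp u - 1\<bar> \<le> \<bar>a\<bar> * exp (2 * w)"
proof -
  obtain t where t: "\<bar>t\<bar> \<le> \<bar>u\<bar>" "exp u = (\<Sum>m<1. u ^ m / fact m) + exp t / fact 1 * u ^ 1"
    using Maclaurin_exp_le[of u 1] by blast
  have "\<bar>a\<bar> * w \<le> 1 * w"
    using assms by (intro mult_right_mono) auto
  then have tw: "t \<le> w" using t(1) assms(1) by linarith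
  have "\<bar>exp u - 1\<bar> = exp t * \<bar>u\<bar>"
    using t(2) by (simp add: abs_mult)
  also have "\<dots> \<le> exp w * (\<bar>a\<bar> * w)"
    using tw assms by (intro mult_mono) auto
  also have "\<dots> \<le> exp w * (\<bar>a\<bar> * exp w)"
    using le_exp_self by (intro mult_left_mono) auto
  also have "\<dots> = \<bar>a\<bar> * exp (2 * w)"
    by (simp flip: exp_add add: algebra_simps)
  finally show ?thesis .
qed

text \<open>Gaussian smoothing turns bounded functions into Lipschitz ones, with one constant for all functions
  with values in \<open>[0, 1]\<close>. A shift of the mean by \<open>a\<close> multiplies the density by \<open>e\<^sup>u\<close> with \<open>u\<close> of order
  \<open>\<bar>a\<bar>\<close>, and \<open>\<bar>e\<^sup>u - 1\<bar>\<close> is at most \<open>\<bar>a\<bar>\<close> times an integrable function when \<open>\<bar>a\<bar> \<le> 1\<close>; for larger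
  shifts the trivial bound \<open>1\<close> is enough.\<close>

lemma gauss_shift_lipschitz:
  assumes \<sigma>: "0 < \<sigma>"
  obtains C where "0 \<le> C"
    "\<And>B x y. B \<in> borel_measurable borel \<Longrightarrow> (\<And>z. 0 \<le> B z \<and> B z \<le> (1::real)) \<Longrightarrow>
       \<bar>(\<integral>e. B (x + e) \<partial>gauss \<mu> \<sigma>) - (\<integral>e. B (y + e) \<partial>gauss \<mu> \<sigma>)\<bar> \<le> C * \<bar>x - y\<bar>"
proof
  interpret N: prob_space "gauss \<mu> \<sigma>" using \<sigma> by (rule prob_space_gauss)
  define w where "w x = (2 * \<bar>x - \<mu>\<bar> + 1) / (2 * \<sigma>\<^sup>2)" for x
  have [measurable]: "w \<in> borel_measurable borel" unfolding w_def by measurable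
  have w0: "0 \<le> w x" for x by (simp add: w_def)
  have int_w: "integrable (gauss \<mu> \<sigma>) (\<lambda>x. exp (2 * w x))"
  proof -
    have "exp (2 * w x) \<le> exp ((2 * \<bar>\<mu>\<bar> + 1) / \<sigma>\<^sup>2) * exp (2 / \<sigma>\<^sup>2 * \<bar>x\<bar>)" for x
    proof -
      have "2 * w x = (2 * \<bar>x - \<mu>\<bar> + 1) / \<sigma>\<^sup>2"
        using \<sigma> by (simp add: w_def field_simps)
      also have "\<dots> \<le> ((2 * \<bar>\<mu>\<bar> + 1) + 2 * \<bar>x\<bar>) / \<sigma>\<^sup>2"
        using abs_triangle_ineq4[of x \<mu>] by (intro divide_right_mono) simp_all
      finally show ?thesis by (simp flip: exp_add add: add_divide_distrib)
    qed
    then show ?thesis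
      by (intro Bochner_Integration.integrable_bound
        [OF integrable_mult_right[OF integrable_gauss_exp_abs[OF \<sigma>, of \<mu> "2 / \<sigma>\<^sup>2"], of "exp ((2 * \<bar>\<mu>\<bar> + 1) / \<sigma>\<^sup>2)"]]) auto
  qed
  define C where "C = (\<integral>x. exp (2 * w x) \<partial>gauss \<mu> \<sigma>) + 1"
  have C1: "1 \<le> C" by (simp add: C_def)
  then show "0 \<le> C" by simp
  have shift: "\<bar>(\<integral>e. B (a + e) \<partial>gauss \<mu> \<sigma>) - (\<integral>e. B e \<partial>gauss \<mu> \<sigma>)\<bar> \<le> C * \<bar>a\<bar>"
    if [measurable]: "B \<in> borel_measurable borel" and B: "\<And>z. 0 \<le> B z \<and> B z \<le> (1::real)" for B a
  proof (cases "\<bar>a\<bar> \<le> 1")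
    case False
    have "0 \<le> (\<integral>e. B (a + e) \<partial>gauss \<mu> \<sigma>)" "0 \<le> (\<integral>e. B e \<partial>gauss \<mu> \<sigma>)"
      using B by (auto intro!: integral_nonneg)
    moreover have "(\<integral>e. B (a + e) \<partial>gauss \<mu> \<sigma>) \<le> 1" "(\<integral>e. B e \<partial>gauss \<mu> \<sigma>) \<le> 1"
      using B by (auto intro!: N.integral_le_const N.integrable_const_bound[where B = 1])
    ultimately have "\<bar>(\<integral>e. B (a + e) \<partial>gauss \<mu> \<sigma>) - (\<integral>e. B e \<partial>gauss \<mu> \<sigma>)\<bar> \<le> 1 * 1"
      by linarith
    also have "\<dots> \<le> C * \<bar>a\<bar>"
      using False C1 by (intro mult_mono) auto
    finally show ?thesis .
  next
    case True
    define u where "u x = (2 * a * (x - \<mu>) - a\<^sup>2) / (2 * \<sigma>\<^sup>2)" for x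
    have [measurable]: "u \<in> borel_measurable borel" unfolding u_def by measurable
    have dens: "normal_density \<mu> \<sigma> (x - a) = normal_density \<mu> \<sigma> x * exp (u x)" for x
    proof -
      have "- (x - a - \<mu>)\<^sup>2 / (2 * \<sigma>\<^sup>2) = - (x - \<mu>)\<^sup>2 / (2 * \<sigma>\<^sup>2) + u x"
        unfolding u_def add_divide_distrib[symmetric]
        by (rule arg_cong2[where f = "(/)"]) (simp_all add: power2_eq_square algebra_simps)
      then show ?thesis unfolding normal_density_def by (simp only: exp_add mult.assoc)
    qed
    have u_le: "\<bar>u x\<bar> \<le> \<bar>a\<bar> * w x" for x
    proof -
      have "\<bar>2 * a * (x - \<mu>) - a\<^sup>2\<bar> \<le> 2 * \<bar>a\<bar> * \<bar>x - \<mu>\<bar> + \<bar>a\<bar> * \<bar>a\<bar>"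
        by (rule order_trans[OF abs_triangle_ineq4]) (simp add: abs_mult power2_eq_square)
      also have "\<dots> \<le> 2 * \<bar>a\<bar> * \<bar>x - \<mu>\<bar> + \<bar>a\<bar> * 1"
        using True by (intro add_left_mono mult_left_mono) auto
      also have "\<dots> = \<bar>a\<bar> * (2 * \<bar>x - \<mu>\<bar> + 1)" by (simp add: algebra_simps)
      finally show ?thesis by (simp add: u_def w_def divide_right_mono)
    qed
    have e_le: "\<bar>exp (u x) - 1\<bar> \<le> \<bar>a\<bar> * exp (2 * w x)" for x
      using exp_minus_one_abs_le[OF u_le True w0] .
    have int_d: "integrable (gauss \<mu> \<sigma>) (\<lambda>x. B x * (exp (u x) - 1))"
    proof (rule Bochner_Integration.integrable_bound[OF integrable_mult_right[OF int_w, of "\<bar>a\<bar>"]])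
      show "AE x in gauss \<mu> \<sigma>. norm (B x * (exp (u x) - 1)) \<le> norm (\<bar>a\<bar> * exp (2 * w x))"
        using B e_le by (intro AE_I2) (auto simp: abs_mult intro!: mult_left_le_one_le intro: order_trans[OF mult_left_le_one_le])
    qed auto
    have intB: "integrable (gauss \<mu> \<sigma>) B"
      using B by (intro N.integrable_const_bound[where B = 1]) auto
    have "(\<integral>e. B (a + e) \<partial>gauss \<mu> \<sigma>) = (\<integral>e. normal_density \<mu> \<sigma> e * B (a + e) \<partial>lborel)"
      by (subst integral_gauss) auto
    also have "\<dots> = (\<integral>x. normal_density \<mu> \<sigma> (x - a) * B x \<partial>lborel)"
      by (subst lborel_integral_real_affine[where c = 1 and t = "- a"]) auto
    also have "\<dots> = (\<integral>x. B x * exp (u x) \<partial>gauss \<mu> \<sigma>)"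
      by (subst integral_gauss) (auto simp: dens ac_simps)
    also have "\<dots> = (\<integral>x. B x + B x * (exp (u x) - 1) \<partial>gauss \<mu> \<sigma>)"
      by (simp add: algebra_simps)
    also have "\<dots> = (\<integral>x. B x \<partial>gauss \<mu> \<sigma>) + (\<integral>x. B x * (exp (u x) - 1) \<partial>gauss \<mu> \<sigma>)"
      by (rule Bochner_Integration.integral_add[OF intB int_d])
    finally have "\<bar>(\<integral>e. B (a + e) \<partial>gauss \<mu> \<sigma>) - (\<integral>e. B e \<partial>gauss \<mu> \<sigma>)\<bar> = \<bar>\<integral>x. B x * (exp (u x) - 1) \<partial>gauss \<mu> \<sigma>\<bar>"
      by simp
    also have "\<dots> \<le> (\<integral>x. \<bar>a\<bar> * exp (2 * w x) \<partial>gauss \<mu> \<sigma>)"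
      using B e_le
      by (intro integral_abs_bound[THEN order_trans] integral_mono integrable_abs int_d integrable_mult_right int_w)
         (auto simp: abs_mult intro: order_trans[OF mult_left_le_one_le])
    also have "\<dots> = \<bar>a\<bar> * (\<integral>x. exp (2 * w x) \<partial>gauss \<mu> \<sigma>)" by simp
    also have "\<dots> \<le> \<bar>a\<bar> * C" by (intro mult_left_mono) (auto simp: C_def)
    finally show ?thesis by (simp add: mult.commute)
  qed
  fix B :: "real \<Rightarrow> real" and x y assume [measurable]: "B \<in> borel_measurable borel" and B: "\<And>z. 0 \<le> B z \<and> B z \<le> (1::real)"
  show "\<bar>(\<integral>e. B (x + e) \<partial>gauss \<mu> \<sigma>) - (\<integral>e. B (y + e) \<partial>gauss \<mu> \<sigma>)\<bar> \<le> C * \<bar>x - y\<bar>"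
    using shift[of "\<lambda>z. B (y + z)" "x - y"] B by (simp add: algebra_simps)
qed

lemma measure_gauss_interval_pos:
  assumes "0 < s" "a < b"
  shows "0 < measure (gauss m s) {a<..<b}"
proof -
  interpret N: prob_space "gauss m s" using assms(1) by (rule prob_space_gauss)
  have "emeasure (gauss m s) {a<..<b} \<noteq> 0"
  proof
    assume "emeasure (gauss m s) {a<..<b} = 0"
    then have "(\<integral>\<^sup>+x. ennreal (normal_density m s x) * indicator {a<..<b} x \<partial>lborel) = 0"
      by (simp add: gauss_def emeasure_density)
    then have "AE x in lborel. ennreal (normal_density m s x) * indicator {a<..<b} x = 0"
      by (subst (asm) nn_integral_0_iff_AE) auto
    then have "AE x in lborel. x \<notin> {a<..<b}"
    proof (rule AE_mp, intro AE_I2 impI)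
      fix x assume "ennreal (normal_density m s x) * indicator {a<..<b} x = 0"
      then show "x \<notin> {a<..<b}"
        using normal_density_pos[OF assms(1), of m x] by (auto simp: indicator_def ennreal_eq_0_iff)
    qed
    then have "emeasure lborel {a<..<b} = 0"
      by (subst (asm) AE_iff_measurable[of "{a<..<b}"]) auto
    then show False using assms(2) by simp
  qed
  then show ?thesis
    using N.emeasure_eq_measure by (simp add: zero_less_measure_iff)
qed

definition std_normal_cdf :: "real \<Rightarrow> real" where
  "std_normal_cdf t = measure (gauss 0 1) {..<t}"

lemma strict_mono_std_normal_cdf: "strict_mono std_normal_cdf"
proof (rule strict_monoI)
  fix x y :: real assume "x < y"
  interpret N: prob_space "gauss 0 1" by (rule prob_space_gauss) simp
  have "std_normal_cdf x < measure (gauss 0 1) {..<x} + measure (gauss 0 1) {x<..<y}"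
    using measure_gauss_interval_pos[of 1 x y 0] \<open>x < y\<close> by (simp add: std_normal_cdf_def)
  also have "\<dots> = measure (gauss 0 1) ({..<x} \<union> {x<..<y})"
    by (rule N.finite_measure_Union[symmetric]) auto
  also have "\<dots> \<le> std_normal_cdf y"
    unfolding std_normal_cdf_def using \<open>x < y\<close> by (intro N.finite_measure_mono) auto
  finally show "std_normal_cdf x < std_normal_cdf y" .
qed

lemma distr_gauss_affine:
  assumes "0 < \<sigma>" "\<alpha> \<noteq> 0"
  shows "distr (gauss \<mu> \<sigma>) borel (\<lambda>x. \<beta> + \<alpha> * x) = gauss (\<beta> + \<alpha> * \<mu>) (\<bar>\<alpha>\<bar> * \<sigma>)"
proof -
  interpret N: prob_space "gauss \<mu> \<sigma>" using assms(1) by (rule prob_space_gauss)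
  have "distributed (gauss \<mu> \<sigma>) lborel (\<lambda>x. x) (\<lambda>x. ennreal (normal_density \<mu> \<sigma> x))"
    by (auto simp: distributed_gauss distr_id2)
  from N.normal_density_affine[OF this assms] show ?thesis
    by (simp add: distributed_gauss)
qed

lemma measure_gauss_lessThan:
  assumes "0 < \<sigma>"
  shows "measure (gauss \<mu> \<sigma>) {..<c} = std_normal_cdf ((c - \<mu>) / \<sigma>)"
proof -
  have "measure (gauss \<mu> \<sigma>) {..<c} = measure (distr (gauss 0 1) borel (\<lambda>x. \<mu> + \<sigma> * x)) {..<c}"
    using distr_gauss_affine[of 1 \<sigma> 0 \<mu>] assms by simp
  also have "\<dots> = measure (gauss 0 1) {x. \<mu> + \<sigma> * x < c}"
    by (subst measure_distr) (auto intro!: arg_cong[where f = "measure _"])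
  also have "{x. \<mu> + \<sigma> * x < c} = {..<(c - \<mu>) / \<sigma>}"
    using assms by (auto simp: field_simps)
  finally show ?thesis by (simp add: std_normal_cdf_def)
qed

lemma exp_le_quadratic:
  fixes t :: real
  shows "exp t \<le> 1 + t + t\<^sup>2 * exp \<bar>t\<bar>"
proof -
  obtain u where u: "\<bar>u\<bar> \<le> \<bar>t\<bar>" "exp t = (\<Sum>m<2. t ^ m / fact m) + exp u / fact 2 * t ^ 2"
    using Maclaurin_exp_le[of t 2] by blast
  have "exp u / fact 2 * t ^ 2 \<le> exp \<bar>t\<bar> * t\<^sup>2"
    using u(1) exp_le_cancel_iff[of u "\<bar>t\<bar>"] exp_gt_zero[of u]
    by (intro mult_right_mono) (simp_all add: fact_numeral del: exp_gt_zero exp_le_cancel_iff, linarith)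
  then show ?thesis using u(2) by (simp add: numeral_2_eq_2 mult.commute)
qed

text \<open>A bound of Hoeffding type for functions that are Lipschitz up to a bounded error. Such a function
  deviates from its mean by at most \<open>w x = A + l \<bar>x\<bar>\<close>, which has all exponential moments, so the
  quadratic estimate of \<open>exp\<close> leaves an error of order \<open>k\<^sup>2\<close>. The constant depends on \<open>\<mu>\<close>, \<open>\<sigma>\<close> and \<open>l\<close>
  alone, which is what permits the estimate to be iterated along a path. The additive error \<open>2\<close> leaves room for
  two functions with values in \<open>[0, 1]\<close>.\<close>

lemma coarse_lipschitz_mgf:
  assumes \<sigma>: "0 < \<sigma>" and l: "0 \<le> l"
  obtains C where "0 < C"
    "\<And>F k. F \<in> borel_measurable borel \<Longrightarrow> (\<And>x y. \<bar>F x - F y\<bar> \<le> 2 + l * \<bar>x - y\<bar>) \<Longrightarrow> 0 \<le> k \<Longrightarrow> k \<le> 1 \<Longrightarrow>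
       integrable (gauss \<mu> \<sigma>) F \<and>
       (\<integral>\<^sup>+x. ennreal (exp (k * F x)) \<partial>gauss \<mu> \<sigma>) \<le> ennreal (exp (k * (\<integral>x. F x \<partial>gauss \<mu> \<sigma>) + C * k\<^sup>2))"
proof
  interpret N: prob_space "gauss \<mu> \<sigma>" using \<sigma> by (rule prob_space_gauss)
  define A where "A = 2 + l * (\<integral>y. \<bar>y\<bar> \<partial>gauss \<mu> \<sigma>)"
  define w where "w x = A + l * \<bar>x\<bar>" for x
  have A0: "0 \<le> A" unfolding A_def using l by (intro add_nonneg_nonneg mult_nonneg_nonneg integral_nonneg) auto
  have w0: "0 \<le> w x" for x unfolding w_def using A0 l by (intro add_nonneg_nonneg mult_nonneg_nonneg) auto
  have [measurable]: "w \<in> borel_measurable borel" unfolding w_def by measurable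
  have int_w: "integrable (gauss \<mu> \<sigma>) (\<lambda>x. exp (3 * w x))"
    using integrable_mult_right[OF integrable_gauss_exp_abs[OF \<sigma>, of \<mu> "3 * l"], of "exp (3 * A)"]
    by (simp add: w_def distrib_left mult.assoc exp_add)
  define C where "C = (\<integral>x. exp (3 * w x) \<partial>gauss \<mu> \<sigma>) + 1"
  show "0 < C" unfolding C_def by (intro add_nonneg_pos integral_nonneg) auto
  fix F :: "real \<Rightarrow> real" and k :: real
  assume [measurable]: "F \<in> borel_measurable borel" and F: "\<And>x y. \<bar>F x - F y\<bar> \<le> 2 + l * \<bar>x - y\<bar>"
    and k: "0 \<le> k" "k \<le> 1"
  have intabs: "integrable (gauss \<mu> \<sigma>) (\<lambda>y. \<bar>y\<bar>)"
    by (rule integrable_gauss_abs[OF \<sigma>])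
  have intF: "integrable (gauss \<mu> \<sigma>) F"
  proof (rule Bochner_Integration.integrable_bound[where f = "\<lambda>x. (\<bar>F 0\<bar> + 2) + l * \<bar>x\<bar>"])
    show "AE x in gauss \<mu> \<sigma>. norm (F x) \<le> norm (\<bar>F 0\<bar> + 2 + l * \<bar>x\<bar>)"
      using F[of _ 0] by (intro AE_I2) (smt (verit) diff_zero real_norm_def)
  qed (use intabs in auto)
  define m where "m = (\<integral>x. F x \<partial>gauss \<mu> \<sigma>)"
  have dev: "\<bar>F x - m\<bar> \<le> w x" for x
  proof -
    have "F x - m = (\<integral>y. F x - F y \<partial>gauss \<mu> \<sigma>)"
      using intF N.prob_space by (simp add: m_def)
    also have "\<bar>\<dots>\<bar> \<le> (\<integral>y. (2 + l * \<bar>x\<bar>) + l * \<bar>y\<bar> \<partial>gauss \<mu> \<sigma>)"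
    proof (intro integral_abs_bound[THEN order_trans] integral_mono integrable_abs)
      fix y
      have "l * \<bar>x - y\<bar> \<le> l * (\<bar>x\<bar> + \<bar>y\<bar>)" using l by (intro mult_left_mono) auto
      then show "\<bar>F x - F y\<bar> \<le> 2 + l * \<bar>x\<bar> + l * \<bar>y\<bar>"
        using F[of x y] by (simp add: distrib_left)
    qed (use intF intabs in auto)
    also have "\<dots> = w x"
      using intabs N.prob_space by (simp add: w_def A_def)
    finally show ?thesis .
  qed
  define R where "R x = 1 + k * (F x - m) + k\<^sup>2 * exp (3 * w x)" for x
  have pt: "exp (k * (F x - m)) \<le> R x" for x
  proof -
    have kd: "\<bar>k * (F x - m)\<bar> \<le> w x"
      using dev[of x] k w0[of x] by (simp add: abs_mult mult_left_le_one_le order_trans[OF mult_left_le_one_le])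
    have "(k * (F x - m))\<^sup>2 * exp \<bar>k * (F x - m)\<bar> \<le> (k\<^sup>2 * (w x)\<^sup>2) * exp (w x)"
      using dev[of x] w0[of x] kd
      by (intro mult_mono) (auto simp: power_mult_distrib intro!: mult_left_mono abs_le_square_iff[THEN iffD1])
    also have "\<dots> \<le> (k\<^sup>2 * (exp (w x))\<^sup>2) * exp (w x)"
      using le_exp_self w0 by (intro mult_right_mono mult_left_mono power_mono) auto
    also have "\<dots> = k\<^sup>2 * exp (3 * w x)"
      by (simp add: power2_eq_square flip: exp_add)
    finally show ?thesis
      using exp_le_quadratic[of "k * (F x - m)"] by (simp add: R_def)
  qed
  have intR: "integrable (gauss \<mu> \<sigma>) R"
    unfolding R_def using intF int_w by auto
  have R0: "0 \<le> R x" for x using pt[of x] exp_gt_zero[of "k * (F x - m)"] by linarith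
  have "(\<integral>\<^sup>+x. ennreal (exp (k * F x)) \<partial>gauss \<mu> \<sigma>) \<le> (\<integral>\<^sup>+x. ennreal (exp (k * m)) * ennreal (R x) \<partial>gauss \<mu> \<sigma>)"
  proof (rule nn_integral_mono)
    fix x
    have "exp (k * F x) = exp (k * m) * exp (k * (F x - m))"
      by (simp flip: exp_add add: algebra_simps)
    also have "\<dots> \<le> exp (k * m) * R x" using pt[of x] by simp
    finally show "ennreal (exp (k * F x)) \<le> ennreal (exp (k * m)) * ennreal (R x)"
      by (simp flip: ennreal_mult' add: ennreal_leI)
  qed
  also have "\<dots> = ennreal (exp (k * m)) * (\<integral>\<^sup>+x. ennreal (R x) \<partial>gauss \<mu> \<sigma>)"
    using intR by (intro nn_integral_cmult) auto
  also have "(\<integral>\<^sup>+x. ennreal (R x) \<partial>gauss \<mu> \<sigma>) = ennreal (\<integral>x. R x \<partial>gauss \<mu> \<sigma>)"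
    using intR R0 by (intro nn_integral_eq_integral) auto
  also have "(\<integral>x. R x \<partial>gauss \<mu> \<sigma>) = 1 + k\<^sup>2 * (C - 1)"
    using intF int_w N.prob_space by (simp add: R_def m_def C_def)
  also have "\<dots> \<le> 1 + C * k\<^sup>2" by (simp add: algebra_simps)
  also have "\<dots> \<le> exp (C * k\<^sup>2)" by (rule exp_ge_add_one_self)
  finally have "(\<integral>\<^sup>+x. ennreal (exp (k * F x)) \<partial>gauss \<mu> \<sigma>) \<le> ennreal (exp (k * m)) * ennreal (exp (C * k\<^sup>2))"
    by (simp add: ennreal_leI mult_left_mono)
  then show "integrable (gauss \<mu> \<sigma>) F \<and>
       (\<integral>\<^sup>+x. ennreal (exp (k * F x)) \<partial>gauss \<mu> \<sigma>) \<le> ennreal (exp (k * (\<integral>x. F x \<partial>gauss \<mu> \<sigma>) + C * k\<^sup>2))"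
    using intF by (simp add: m_def exp_add ennreal_mult')
qed

section \<open>Path expectations of the autoregression\<close>

text \<open>The index is shifted by one, \<open>state \<alpha> e n = X\<^sub>n\<^sub>-\<^sub>1\<close>, so that the initial value \<open>X\<^sub>-\<^sub>1 = 0\<close> is a regular
  member of the sequence and every observation is preceded by a state.\<close>

primrec state :: "real \<Rightarrow> (nat \<Rightarrow> real) \<Rightarrow> nat \<Rightarrow> real" where
  "state \<alpha> e 0 = 0"
| "state \<alpha> e (Suc n) = \<alpha> * state \<alpha> e n + e n"

lemma ar1_eq_state: "ar1 \<alpha> \<epsilon> n \<omega> = state \<alpha> (\<lambda>i. \<epsilon> i \<omega>) (Suc n)"
  by (induction n) simp_all

lemma state_cong: "(\<And>i. i < n \<Longrightarrow> e i = e' i) \<Longrightarrow> state \<alpha> e n = state \<alpha> e' n"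
  by (induction n) simp_all

lemma measurable_state_PiM [measurable]:
  "n \<le> N \<Longrightarrow> (\<lambda>e. state \<alpha> e n) \<in> borel_measurable (PiM {..<N} (\<lambda>_. borel))"
proof (induction n)
  case (Suc n)
  then have [measurable]: "(\<lambda>e. state \<alpha> e n) \<in> borel_measurable (PiM {..<N} (\<lambda>_. borel))"
    by simp
  have [measurable]: "(\<lambda>e. e n) \<in> borel_measurable (PiM {..<N} (\<lambda>_. borel :: real measure))"
    using Suc.prems by (intro measurable_component_singleton) auto
  show ?case by (simp, measurable)
qed simp

lemma measurable_state [measurable]:
  assumes [measurable]: "\<And>i. \<epsilon> i \<in> borel_measurable M"
  shows "(\<lambda>\<omega>. state \<alpha> (\<lambda>i. \<epsilon> i \<omega>) n) \<in> borel_measurable M"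
  by (induction n) simp_all

text \<open>The expectation of \<open>(\<Prod>i<n. f i X\<^sub>i\<^sub>-\<^sub>1 X\<^sub>i) * h X\<^sub>n\<^sub>-\<^sub>1\<close>, computed by integrating out the last innovation
  first. It depends on the parameter only, and covers both likelihoods (\<open>f i\<close> an indicator of cells)
  and exponential moments (\<open>f i\<close> the exponential of a summand).\<close>

primrec path_expect ::
    "real \<Rightarrow> real measure \<Rightarrow> (nat \<Rightarrow> real \<Rightarrow> real \<Rightarrow> ennreal) \<Rightarrow> nat \<Rightarrow> (real \<Rightarrow> ennreal) \<Rightarrow> ennreal" where
  "path_expect \<alpha> \<nu> f 0 h = h 0"
| "path_expect \<alpha> \<nu> f (Suc n) h =
     path_expect \<alpha> \<nu> f n (\<lambda>x. \<integral>\<^sup>+e. f n x (\<alpha> * x + e) * h (\<alpha> * x + e) \<partial>\<nu>)"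

lemma path_expect_mono:
  "(\<And>x. h x \<le> h' x) \<Longrightarrow> path_expect \<alpha> \<nu> f n h \<le> path_expect \<alpha> \<nu> f n h'"
proof (induction n arbitrary: h h')
  case (Suc n)
  show ?case unfolding path_expect.simps
    by (intro Suc.IH nn_integral_mono mult_left_mono Suc.prems) simp
qed simp

lemma measurable_path_step:
  assumes [measurable_cong]: "sets \<nu> = sets borel" and "prob_space \<nu>"
  assumes [measurable]: "case_prod g \<in> borel_measurable (borel \<Otimes>\<^sub>M borel)"
    "h \<in> borel_measurable borel"
  shows "(\<lambda>x. \<integral>\<^sup>+e. g x (\<alpha> * x + e) * h (\<alpha> * x + e) \<partial>\<nu>) \<in> borel_measurable (borel :: real measure)"
proof -
  interpret prob_space \<nu> by fact
  show ?thesis by measurable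
qed

lemma path_expect_cmult:
  assumes \<nu>: "sets \<nu> = sets borel" "prob_space \<nu>"
    and f: "\<And>i. case_prod (f i) \<in> borel_measurable (borel \<Otimes>\<^sub>M borel)"
    and "h \<in> borel_measurable borel"
  shows "path_expect \<alpha> \<nu> f n (\<lambda>x. c * h x) = c * path_expect \<alpha> \<nu> f n h"
  using assms(4)
proof (induction n arbitrary: h)
  case (Suc n)
  note [measurable] = f[of n] Suc.prems and [measurable_cong] = \<nu>(1)
  have "(\<integral>\<^sup>+e. f n x (\<alpha> * x + e) * (c * h (\<alpha> * x + e)) \<partial>\<nu>) =
      c * (\<integral>\<^sup>+e. f n x (\<alpha> * x + e) * h (\<alpha> * x + e) \<partial>\<nu>)" for x
    by (subst nn_integral_cmult[symmetric]) (measurable, simp add: ac_simps)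
  then show ?case
    using Suc.IH[OF measurable_path_step[OF \<nu> f Suc.prems]] by simp
qed simp

text \<open>The innovation \<open>\<epsilon> n\<close> is independent of its predecessors, so it can be integrated out with the
  past held fixed.\<close>

lemma markov_step:
  assumes "prob_space M" "iid_normal M \<mu> \<sigma> \<epsilon>"
    and [measurable]: "G \<in> borel_measurable (PiM {..<n} (\<lambda>_. borel) \<Otimes>\<^sub>M borel)"
  shows "(\<integral>\<^sup>+\<omega>. G (restrict (\<lambda>i. \<epsilon> i \<omega>) {..<n}, \<epsilon> n \<omega>) \<partial>M) =
         (\<integral>\<^sup>+\<omega>. (\<integral>\<^sup>+e. G (restrict (\<lambda>i. \<epsilon> i \<omega>) {..<n}, e) \<partial>gauss \<mu> \<sigma>) \<partial>M)"
proof -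
  interpret prob_space M by fact
  have ind: "indep_vars (\<lambda>_. borel) \<epsilon> UNIV"
    and dist: "\<And>n. \<epsilon> n \<in> borel_measurable M \<and> distr M borel (\<epsilon> n) = gauss \<mu> \<sigma>"
    using assms(2) by (auto simp: iid_normal_def distributed_gauss)
  have [measurable]: "\<epsilon> i \<in> borel_measurable M" for i using dist by auto
  let ?P = "PiM {..<n} (\<lambda>_. borel :: real measure)"
  let ?Q = "PiM {n} (\<lambda>_. borel :: real measure)"
  let ?X = "\<lambda>\<omega>. restrict (\<lambda>i. \<epsilon> i \<omega>) {..<n}"
  let ?Z = "\<lambda>\<omega>. restrict (\<lambda>i. \<epsilon> i \<omega>) {n}"
  have joint: "distr M ?P ?X \<Otimes>\<^sub>M distr M ?Q ?Z = distr M (?P \<Otimes>\<^sub>M ?Q) (\<lambda>\<omega>. (?X \<omega>, ?Z \<omega>))"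
    using indep_var_restrict[OF ind, of "{..<n}" "{n}"] by (simp add: indep_var_distribution_eq)
  interpret Z: prob_space "distr M ?Q ?Z" by (rule prob_space_distr) measurable
  interpret G: prob_space "gauss \<mu> \<sigma>"
    using prob_space_distr[of "\<epsilon> 0" borel] dist[of 0] by simp
  have [measurable]: "(\<lambda>z. z n) \<in> borel_measurable ?Q"
    by (intro measurable_component_singleton) auto
  have "(\<integral>\<^sup>+\<omega>. G (?X \<omega>, \<epsilon> n \<omega>) \<partial>M) =
      (\<integral>\<^sup>+z. G (fst z, snd z n) \<partial>(distr M ?P ?X \<Otimes>\<^sub>M distr M ?Q ?Z))"
    unfolding joint by (subst nn_integral_distr) simp_all
  also have "\<dots> = (\<integral>\<^sup>+x. (\<integral>\<^sup>+z. G (x, z n) \<partial>distr M ?Q ?Z) \<partial>distr M ?P ?X)"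
    by (subst Z.nn_integral_fst[symmetric]) simp_all
  also have "\<dots> = (\<integral>\<^sup>+\<omega>. (\<integral>\<^sup>+z. G (?X \<omega>, z n) \<partial>distr M ?Q ?Z) \<partial>M)"
    by (rule nn_integral_distr) simp_all
  also have "\<dots> = (\<integral>\<^sup>+\<omega>. (\<integral>\<^sup>+e. G (?X \<omega>, e) \<partial>gauss \<mu> \<sigma>) \<partial>M)"
  proof (rule nn_integral_cong)
    fix \<omega> assume [measurable]: "\<omega> \<in> space M"
    have [measurable]: "?X \<omega> \<in> space ?P" by (simp add: space_PiM)
    have "(\<integral>\<^sup>+z. G (?X \<omega>, z n) \<partial>distr M ?Q ?Z) = (\<integral>\<^sup>+\<omega>'. G (?X \<omega>, \<epsilon> n \<omega>') \<partial>M)"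
      by (subst nn_integral_distr) simp_all
    also have "\<dots> = (\<integral>\<^sup>+e. G (?X \<omega>, e) \<partial>distr M borel (\<epsilon> n))"
      by (subst nn_integral_distr) simp_all
    finally show "(\<integral>\<^sup>+z. G (?X \<omega>, z n) \<partial>distr M ?Q ?Z) = (\<integral>\<^sup>+e. G (?X \<omega>, e) \<partial>gauss \<mu> \<sigma>)"
      using dist by simp
  qed
  finally show ?thesis .
qed

lemma nn_integral_path:
  assumes M: "prob_space M" "iid_normal M \<mu> \<sigma> \<epsilon>" and \<sigma>: "0 < \<sigma>"
    and f: "\<And>i. case_prod (f i) \<in> borel_measurable (borel \<Otimes>\<^sub>M borel)"
    and "h \<in> borel_measurable borel"
  shows "(\<integral>\<^sup>+\<omega>. (\<Prod>i<n. f i (state \<alpha> (\<lambda>i. \<epsilon> i \<omega>) i) (state \<alpha> (\<lambda>i. \<epsilon> i \<omega>) (Suc i))) *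
             h (state \<alpha> (\<lambda>i. \<epsilon> i \<omega>) n) \<partial>M) = path_expect \<alpha> (gauss \<mu> \<sigma>) f n h"
  using assms(5)
proof (induction n arbitrary: h)
  case 0
  interpret prob_space M by fact
  show ?case by (simp add: emeasure_space_1)
next
  case (Suc n)
  note [measurable] = f Suc.prems
  define F where "F e = (\<Prod>i<n. f i (state \<alpha> e i) (state \<alpha> e (Suc i)))" for e
  let ?G = "\<lambda>(x, e). F x * (f n (state \<alpha> x n) (\<alpha> * state \<alpha> x n + e) * h (\<alpha> * state \<alpha> x n + e))"
  interpret G: prob_space "gauss \<mu> \<sigma>" using \<sigma> by (rule prob_space_gauss)
  have [measurable]: "(\<lambda>e. f i (state \<alpha> e i) (state \<alpha> e (Suc i))) \<in> borel_measurable (PiM {..<n} (\<lambda>_. borel))"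
    if "i < n" for i
  proof -
    have [measurable]: "(\<lambda>e. state \<alpha> e i) \<in> borel_measurable (PiM {..<n} (\<lambda>_. borel))"
      "(\<lambda>e. state \<alpha> e (Suc i)) \<in> borel_measurable (PiM {..<n} (\<lambda>_. borel))"
      using that by (auto intro!: measurable_state_PiM simp del: state.simps)
    show ?thesis by measurable
  qed
  have [measurable]: "F \<in> borel_measurable (PiM {..<n} (\<lambda>_. borel))"
    unfolding F_def by (intro borel_measurable_prod_ennreal) (simp del: state.simps)
  have [measurable]: "(\<lambda>e. state \<alpha> e n) \<in> borel_measurable (PiM {..<n} (\<lambda>_. borel))"
    by (rule measurable_state_PiM) simp
  have [simp]: "state \<alpha> (restrict (\<lambda>i. \<epsilon> i \<omega>) {..<n}) i = state \<alpha> (\<lambda>i. \<epsilon> i \<omega>) i" if "i \<le> n" for i \<omega>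
    using that by (intro state_cong) auto
  have Fr: "F (restrict (\<lambda>i. \<epsilon> i \<omega>) {..<n}) = F (\<lambda>i. \<epsilon> i \<omega>)" for \<omega>
    unfolding F_def by (intro prod.cong refl arg_cong2[where f = "f _"]) (auto intro!: state_cong simp del: state.simps)
  have split: "(\<Prod>i<Suc n. f i (state \<alpha> e i) (state \<alpha> e (Suc i))) * h (state \<alpha> e (Suc n)) =
      F e * (f n (state \<alpha> e n) (\<alpha> * state \<alpha> e n + e n) * h (\<alpha> * state \<alpha> e n + e n))" for e
    by (simp add: F_def mult.assoc)
  have "(\<integral>\<^sup>+\<omega>. (\<Prod>i<Suc n. f i (state \<alpha> (\<lambda>i. \<epsilon> i \<omega>) i) (state \<alpha> (\<lambda>i. \<epsilon> i \<omega>) (Suc i))) *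
             h (state \<alpha> (\<lambda>i. \<epsilon> i \<omega>) (Suc n)) \<partial>M) =
        (\<integral>\<^sup>+\<omega>. ?G (restrict (\<lambda>i. \<epsilon> i \<omega>) {..<n}, \<epsilon> n \<omega>) \<partial>M)"
    unfolding split by (simp add: Fr)
  also have "\<dots> = (\<integral>\<^sup>+\<omega>. (\<integral>\<^sup>+e. ?G (restrict (\<lambda>i. \<epsilon> i \<omega>) {..<n}, e) \<partial>gauss \<mu> \<sigma>) \<partial>M)"
    by (rule markov_step[OF M]) measurable
  also have "\<dots> = (\<integral>\<^sup>+\<omega>. F (\<lambda>i. \<epsilon> i \<omega>) * (\<lambda>x. \<integral>\<^sup>+e. f n x (\<alpha> * x + e) * h (\<alpha> * x + e) \<partial>gauss \<mu> \<sigma>)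
               (state \<alpha> (\<lambda>i. \<epsilon> i \<omega>) n) \<partial>M)"
    by (simp add: Fr nn_integral_cmult)
  also have "\<dots> = path_expect \<alpha> (gauss \<mu> \<sigma>) f (Suc n) h"
    unfolding F_def using Suc.IH[OF measurable_path_step[OF _ prob_space_gauss[OF \<sigma>] f Suc.prems]] by simp
  finally show ?case .
qed

section \<open>The stationary law\<close>

text \<open>The fixed point of \<open>N(m, s\<^sup>2) \<mapsto> N(\<alpha>m + \<mu>, \<alpha>\<^sup>2s\<^sup>2 + \<sigma>\<^sup>2)\<close>.\<close>

definition stationary :: "real \<Rightarrow> real \<Rightarrow> real \<Rightarrow> real measure" where
  "stationary \<alpha> \<mu> \<sigma> = gauss (\<mu> / (1 - \<alpha>)) (\<sigma> / sqrt (1 - \<alpha>\<^sup>2))"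

text \<open>The mean of \<open>g\<close> of two consecutive states when the first of them has the stationary law.\<close>

definition stationary_mean :: "real \<Rightarrow> real \<Rightarrow> real \<Rightarrow> (real \<Rightarrow> real \<Rightarrow> real) \<Rightarrow> real" where
  "stationary_mean \<alpha> \<mu> \<sigma> g = (\<integral>x. (\<integral>e. g x (\<alpha> * x + e) \<partial>gauss \<mu> \<sigma>) \<partial>stationary \<alpha> \<mu> \<sigma>)"

lemma sets_stationary [simp, measurable_cong]: "sets (stationary \<alpha> \<mu> \<sigma>) = sets borel"
  by (simp add: stationary_def)

lemma space_stationary [simp]: "space (stationary \<alpha> \<mu> \<sigma>) = UNIV"
  by (simp add: stationary_def)

lemma stationary_sd_pos:
  fixes \<alpha> :: real
  assumes "0 \<le> \<alpha>" "\<alpha> < 1" "0 < \<sigma>"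
  shows "0 < \<sigma> / sqrt (1 - \<alpha>\<^sup>2)"
  using assms by (simp add: power_less_one_iff abs_square_less_1)

lemma prob_space_stationary:
  "0 \<le> \<alpha> \<Longrightarrow> \<alpha> < 1 \<Longrightarrow> 0 < \<sigma> \<Longrightarrow> prob_space (stationary \<alpha> \<mu> \<sigma>)"
  unfolding stationary_def by (intro prob_space_gauss stationary_sd_pos)

text \<open>For \<open>\<alpha> \<noteq> 0\<close> this is the formula for the sum of two independent normal variables. For \<open>\<alpha> = 0\<close> the
  scaled variable is a point mass and the formula does not apply, but then the new state is the
  innovation itself.\<close>

lemma distr_stationary:
  assumes \<alpha>: "0 \<le> \<alpha>" "\<alpha> < 1" and \<sigma>: "0 < \<sigma>"
  shows "distr (stationary \<alpha> \<mu> \<sigma> \<Otimes>\<^sub>M gauss \<mu> \<sigma>) borel (\<lambda>z. \<alpha> * fst z + snd z) = stationary \<alpha> \<mu> \<sigma>"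
proof -
  interpret S: prob_space "stationary \<alpha> \<mu> \<sigma>" using assms by (rule prob_space_stationary)
  interpret N: prob_space "gauss \<mu> \<sigma>" using \<sigma> by (rule prob_space_gauss)
  interpret P: pair_prob_space "stationary \<alpha> \<mu> \<sigma>" "gauss \<mu> \<sigma>" ..
  let ?P = "stationary \<alpha> \<mu> \<sigma> \<Otimes>\<^sub>M gauss \<mu> \<sigma>"
  have d2: "distr ?P borel snd = gauss \<mu> \<sigma>"
  proof (rule measure_eqI)
    fix A assume "A \<in> sets (distr ?P borel snd)"
    then have [measurable]: "A \<in> sets borel" by simp
    have "emeasure (distr ?P borel snd) A = emeasure ?P (UNIV \<times> A)"
      by (subst emeasure_distr) (auto simp: space_pair_measure intro!: arg_cong[where f = "emeasure _"])
    also have "\<dots> = emeasure (stationary \<alpha> \<mu> \<sigma>) UNIV * emeasure (gauss \<mu> \<sigma>) A"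
      by (rule N.emeasure_pair_measure_Times) auto
    finally show "emeasure (distr ?P borel snd) A = emeasure (gauss \<mu> \<sigma>) A"
      using S.emeasure_space_1 by simp
  qed simp
  show ?thesis
  proof (cases "\<alpha> = 0")
    case True
    then show ?thesis using d2 by (simp add: stationary_def cong: distr_cong)
  next
    case False
    let ?m = "\<mu> / (1 - \<alpha>)" and ?s = "\<sigma> / sqrt (1 - \<alpha>\<^sup>2)"
    have s: "0 < ?s" using assms by (rule stationary_sd_pos)
    have \<alpha>s: "0 < \<alpha> * ?s" using \<alpha> False s by (intro mult_pos_pos) auto
    have a1: "distr (stationary \<alpha> \<mu> \<sigma>) borel (\<lambda>x. \<alpha> * x) = gauss (\<alpha> * ?m) (\<alpha> * ?s)"
      using distr_gauss_affine[OF s False, of ?m 0] \<alpha> by (simp add: stationary_def)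
    have j: "distr (stationary \<alpha> \<mu> \<sigma>) borel (\<lambda>x. \<alpha> * x) \<Otimes>\<^sub>M distr (gauss \<mu> \<sigma>) borel (\<lambda>x. x) =
        distr ?P (borel \<Otimes>\<^sub>M borel) (\<lambda>(x, y). (\<alpha> * x, y))"
      by (rule pair_measure_distr) (auto intro!: prob_space_imp_sigma_finite N.prob_space_distr)
    have d1: "distr ?P borel (\<lambda>z. \<alpha> * fst z) = gauss (\<alpha> * ?m) (\<alpha> * ?s)"
    proof -
      have "distr ?P (stationary \<alpha> \<mu> \<sigma>) fst = stationary \<alpha> \<mu> \<sigma>"
        by (rule N.distr_pair_fst)
      then show ?thesis
        unfolding a1[symmetric] by (subst distr_distr[symmetric, of "\<lambda>x. \<alpha> * x" _ _ fst, unfolded o_def]) auto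
    qed
    have ind: "P.indep_var borel (\<lambda>z. \<alpha> * fst z) borel snd"
      unfolding P.indep_var_distribution_eq d1 d2
      using j by (simp add: a1 distr_id2 case_prod_beta')
    have "distributed ?P lborel (\<lambda>z. \<alpha> * fst z + snd z)
        (normal_density (\<alpha> * ?m + \<mu>) (sqrt ((\<alpha> * ?s)\<^sup>2 + \<sigma>\<^sup>2)))"
      using \<alpha>s \<sigma> d1 d2
      by (intro P.add_indep_normal[OF ind]) (simp_all only: distributed_gauss, simp_all)
    moreover have "\<alpha> * ?m + \<mu> = ?m" using \<alpha> by (simp add: field_simps)
    moreover have "sqrt ((\<alpha> * ?s)\<^sup>2 + \<sigma>\<^sup>2) = ?s"
    proof -
      have p: "0 < 1 - \<alpha>\<^sup>2" using \<alpha> by (simp add: power_less_one_iff abs_square_less_1)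
      have "(\<alpha> * ?s)\<^sup>2 + \<sigma>\<^sup>2 = ?s\<^sup>2"
        using p by (simp add: power_mult_distrib power_divide field_simps)
      then show ?thesis using s by (simp only: real_sqrt_abs abs_of_pos)
    qed
    ultimately show ?thesis
      by (simp add: distributed_gauss stationary_def)
  qed
qed

lemma integral_stationary_step:
  assumes \<alpha>: "0 \<le> \<alpha>" "\<alpha> < 1" and \<sigma>: "0 < \<sigma>"
    and F: "integrable (stationary \<alpha> \<mu> \<sigma>) (F :: real \<Rightarrow> real)"
  shows "(\<integral>x. (\<integral>e. F (\<alpha> * x + e) \<partial>gauss \<mu> \<sigma>) \<partial>stationary \<alpha> \<mu> \<sigma>) = (\<integral>x. F x \<partial>stationary \<alpha> \<mu> \<sigma>)"
proof -
  interpret S: prob_space "stationary \<alpha> \<mu> \<sigma>" using \<alpha> \<sigma> by (rule prob_space_stationary)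
  interpret N: prob_space "gauss \<mu> \<sigma>" using \<sigma> by (rule prob_space_gauss)
  interpret P: pair_prob_space "stationary \<alpha> \<mu> \<sigma>" "gauss \<mu> \<sigma>" ..
  let ?P = "stationary \<alpha> \<mu> \<sigma> \<Otimes>\<^sub>M gauss \<mu> \<sigma>"
  have [measurable]: "F \<in> borel_measurable borel"
    using borel_measurable_integrable[OF F] by simp
  have "integrable (distr ?P borel (\<lambda>z. \<alpha> * fst z + snd z)) F"
    using F by (simp add: distr_stationary[OF \<alpha> \<sigma>])
  then have "integrable ?P (\<lambda>z. F (\<alpha> * fst z + snd z))"
    by (subst (asm) integrable_distr_eq) auto
  then have "integrable ?P (\<lambda>(x, e). F (\<alpha> * x + e))"
    by (simp add: case_prod_beta')
  from P.integral_fst[OF this]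
  have "(\<integral>x. (\<integral>e. F (\<alpha> * x + e) \<partial>gauss \<mu> \<sigma>) \<partial>stationary \<alpha> \<mu> \<sigma>) = (\<integral>z. F (\<alpha> * fst z + snd z) \<partial>?P)"
    by (simp add: case_prod_beta')
  also have "\<dots> = (\<integral>x. F x \<partial>distr ?P borel (\<lambda>z. \<alpha> * fst z + snd z))"
    by (subst integral_distr) auto
  finally show ?thesis by (simp add: distr_stationary[OF \<alpha> \<sigma>])
qed

section \<open>Exponential concentration of additive functionals\<close>

text \<open>Sums of a \<open>[0, 1]\<close>-valued and a Lipschitz function. This class is preserved when a bounded summand
  is added and one step of the chain is averaged out: the average of the new bounded summand becomes
  the bounded part, while the old bounded part has been smoothed into a Lipschitz one. Because
  \<open>\<alpha> < 1\<close>, the Lipschitz constants do not accumulate.\<close>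

definition tame :: "real \<Rightarrow> (real \<Rightarrow> real) \<Rightarrow> bool" where
  "tame l H \<longleftrightarrow> (\<exists>B L. H = (\<lambda>x. B x + L x) \<and> B \<in> borel_measurable borel \<and>
     (\<forall>x. 0 \<le> B x \<and> B x \<le> 1) \<and> (\<forall>x y. \<bar>L x - L y\<bar> \<le> l * \<bar>x - y\<bar>))"

lemma borel_measurable_lipschitz:
  fixes L :: "real \<Rightarrow> real"
  assumes "0 \<le> l" "\<And>x y. \<bar>L x - L y\<bar> \<le> l * \<bar>x - y\<bar>"
  shows "L \<in> borel_measurable borel"
proof -
  have "l-lipschitz_on UNIV L"
    using assms by (auto simp: lipschitz_on_def dist_real_def)
  then show ?thesis
    by (intro borel_measurable_continuous_onI lipschitz_on_continuous_on)
qed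

lemma tame_measurable: "0 \<le> l \<Longrightarrow> tame l H \<Longrightarrow> H \<in> borel_measurable borel"
  unfolding tame_def by (auto intro!: borel_measurable_add intro: borel_measurable_lipschitz)

lemma tame_diff_le: "tame l H \<Longrightarrow> \<bar>H x - H y\<bar> \<le> 1 + l * \<bar>x - y\<bar>"
  unfolding tame_def by (auto, smt (verit))

lemma integrable_gauss_coarse_lipschitz:
  assumes "0 < \<sigma>" and [measurable]: "F \<in> borel_measurable borel"
    and F: "\<And>x y. \<bar>F x - F y\<bar> \<le> a + b * \<bar>x - y\<bar>"
  shows "integrable (gauss \<mu> \<sigma>) F"
proof (rule Bochner_Integration.integrable_bound[where f = "\<lambda>x. (\<bar>F 0\<bar> + a) + b * \<bar>x\<bar>"])
  interpret prob_space "gauss \<mu> \<sigma>" using assms(1) by (rule prob_space_gauss)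
  show "integrable (gauss \<mu> \<sigma>) (\<lambda>x. (\<bar>F 0\<bar> + a) + b * \<bar>x\<bar>)"
    using integrable_gauss_abs[OF assms(1)] by auto
  show "AE x in gauss \<mu> \<sigma>. norm (F x) \<le> norm (\<bar>F 0\<bar> + a + b * \<bar>x\<bar>)"
    using F[of _ 0] by (intro AE_I2) (smt (verit) diff_zero real_norm_def)
qed simp

text \<open>One step of backward induction for exponential moments. The function \<open>G\<close> is the conditional mean
  of \<open>g x X' + H X'\<close> given the current state \<open>x\<close>. Its stationary mean is exact, so that in \<open>n\<close> steps the
  mean of \<open>g\<close> is collected \<open>n\<close> times without any error term; only the variance term \<open>C k\<^sup>2\<close> adds up.\<close>

lemma tame_step:
  assumes \<alpha>: "0 \<le> \<alpha>" "\<alpha> < 1" and \<sigma>: "0 < \<sigma>"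
  obtains l C where "0 \<le> l" "0 < C"
    "\<And>g H. case_prod g \<in> borel_measurable (borel \<Otimes>\<^sub>M borel) \<Longrightarrow> (\<And>x y. 0 \<le> g x y \<and> g x y \<le> 1) \<Longrightarrow>
       tame l H \<Longrightarrow> \<exists>G. tame l G \<and>
       (\<integral>x. G x \<partial>stationary \<alpha> \<mu> \<sigma>) = stationary_mean \<alpha> \<mu> \<sigma> g + (\<integral>x. H x \<partial>stationary \<alpha> \<mu> \<sigma>) \<and>
       (\<forall>k x. 0 \<le> k \<longrightarrow> k \<le> 1 \<longrightarrow>
          (\<integral>\<^sup>+e. ennreal (exp (k * (g x (\<alpha> * x + e) + H (\<alpha> * x + e)))) \<partial>gauss \<mu> \<sigma>) \<le>
            ennreal (exp (k * G x + C * k\<^sup>2)))"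
proof -
  interpret S: prob_space "stationary \<alpha> \<mu> \<sigma>" using assms by (rule prob_space_stationary)
  interpret N: prob_space "gauss \<mu> \<sigma>" using \<sigma> by (rule prob_space_gauss)
  obtain C1 :: real where C1: "0 \<le> C1"
    "\<And>B x y. B \<in> borel_measurable borel \<Longrightarrow> (\<And>z. 0 \<le> B z \<and> B z \<le> (1::real)) \<Longrightarrow>
       \<bar>(\<integral>e. B (x + e) \<partial>gauss \<mu> \<sigma>) - (\<integral>e. B (y + e) \<partial>gauss \<mu> \<sigma>)\<bar> \<le> C1 * \<bar>x - y\<bar>"
    using gauss_shift_lipschitz[OF \<sigma>, of \<mu>] by metis
  \<comment> \<open>With this choice \<open>\<alpha> (C1 + l) \<le> l\<close>: smoothing costs \<open>C1\<close>, the contraction by \<open>\<alpha>\<close> regains it.\<close>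
  define l where "l = C1 / (1 - \<alpha>)"
  have l0: "0 \<le> l" using C1(1) \<alpha> by (simp add: l_def)
  have C1_eq: "C1 = l * (1 - \<alpha>)" using \<alpha> by (simp add: l_def)
  obtain C where C: "0 < C"
    "\<And>F k. F \<in> borel_measurable borel \<Longrightarrow> (\<And>x y. \<bar>F x - F y\<bar> \<le> 2 + l * \<bar>x - y\<bar>) \<Longrightarrow> 0 \<le> k \<Longrightarrow> k \<le> 1 \<Longrightarrow>
       integrable (gauss \<mu> \<sigma>) F \<and>
       (\<integral>\<^sup>+x. ennreal (exp (k * F x)) \<partial>gauss \<mu> \<sigma>) \<le> ennreal (exp (k * (\<integral>x. F x \<partial>gauss \<mu> \<sigma>) + C * k\<^sup>2))"
    using coarse_lipschitz_mgf[OF \<sigma> l0, of \<mu>] by metis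
  show thesis
  proof (rule that[OF l0 C(1)])
    fix g :: "real \<Rightarrow> real \<Rightarrow> real" and H :: "real \<Rightarrow> real"
    assume [measurable]: "case_prod g \<in> borel_measurable (borel \<Otimes>\<^sub>M (borel :: real measure))"
      and g: "\<And>x y :: real. 0 \<le> g x y \<and> g x y \<le> (1 :: real)" and "tame l H"
    then obtain B L where H: "H = (\<lambda>x. B x + L x)" and [measurable]: "B \<in> borel_measurable borel"
      and B: "\<And>x. 0 \<le> B x \<and> B x \<le> 1" and L: "\<And>x y. \<bar>L x - L y\<bar> \<le> l * \<bar>x - y\<bar>"
      unfolding tame_def by auto
    have [measurable]: "L \<in> borel_measurable borel" by (rule borel_measurable_lipschitz[OF l0 L])
    have [measurable]: "H \<in> borel_measurable borel" unfolding H by measurable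
    have int_g: "integrable (gauss \<mu> \<sigma>) (\<lambda>e. g x (\<alpha> * x + e))" for x
      using g by (intro N.integrable_const_bound[where B = 1]) auto
    have int_B: "integrable (gauss \<mu> \<sigma>) (\<lambda>e. B (\<alpha> * x + e))" for x
      using B by (intro N.integrable_const_bound[where B = 1]) auto
    have int_L: "integrable (gauss \<mu> \<sigma>) (\<lambda>e. L (\<alpha> * x + e))" for x
    proof (rule integrable_gauss_coarse_lipschitz[OF \<sigma>, where a = 0 and b = l])
      show "\<bar>L (\<alpha> * x + e) - L (\<alpha> * x + e')\<bar> \<le> 0 + l * \<bar>e - e'\<bar>" for e e'
        using L[of "\<alpha> * x + e" "\<alpha> * x + e'"] by simp
    qed simp
    define Pg where "Pg x = (\<integral>e. g x (\<alpha> * x + e) \<partial>gauss \<mu> \<sigma>)" for x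
    define PH where "PH x = (\<integral>e. H (\<alpha> * x + e) \<partial>gauss \<mu> \<sigma>)" for x
    define PB where "PB x = (\<integral>e. B (\<alpha> * x + e) \<partial>gauss \<mu> \<sigma>)" for x
    define PL where "PL x = (\<integral>e. L (\<alpha> * x + e) \<partial>gauss \<mu> \<sigma>)" for x
    have PH: "PH x = PB x + PL x" for x
      unfolding PH_def PB_def PL_def H by (rule Bochner_Integration.integral_add[OF int_B int_L])
    have Pg01: "0 \<le> Pg x \<and> Pg x \<le> 1" for x
      unfolding Pg_def using g int_g by (auto intro!: integral_nonneg N.integral_le_const)
    have [measurable]: "Pg \<in> borel_measurable borel" unfolding Pg_def by measurable
    have lip: "\<bar>PH x - PH y\<bar> \<le> l * \<bar>x - y\<bar>" for x y
    proof -
      have xy: "\<bar>\<alpha> * x - \<alpha> * y\<bar> = \<alpha> * \<bar>x - y\<bar>"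
        using \<alpha> by (simp add: abs_mult flip: right_diff_distrib)
      have "\<bar>PL x - PL y\<bar> = \<bar>\<integral>e. L (\<alpha> * x + e) - L (\<alpha> * y + e) \<partial>gauss \<mu> \<sigma>\<bar>"
        unfolding PL_def using int_L by simp
      also have "\<dots> \<le> (\<integral>e. l * (\<alpha> * \<bar>x - y\<bar>) \<partial>gauss \<mu> \<sigma>)"
      proof (intro integral_abs_bound[THEN order_trans] integral_mono integrable_abs)
        show "\<bar>L (\<alpha> * x + e) - L (\<alpha> * y + e)\<bar> \<le> l * (\<alpha> * \<bar>x - y\<bar>)" for e
          using L[of "\<alpha> * x + e" "\<alpha> * y + e"] xy by simp
      qed (use int_L in auto)
      finally have "\<bar>PL x - PL y\<bar> \<le> l * (\<alpha> * \<bar>x - y\<bar>)"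
        using N.prob_space by simp
      moreover have "\<bar>PB x - PB y\<bar> \<le> C1 * (\<alpha> * \<bar>x - y\<bar>)"
        unfolding PB_def using C1(2)[of B "\<alpha> * x" "\<alpha> * y"] B xy by simp
      ultimately have "\<bar>PH x - PH y\<bar> \<le> (C1 + l) * (\<alpha> * \<bar>x - y\<bar>)"
        unfolding PH distrib_right by linarith
      also have "\<dots> = (1 - (1 - \<alpha>)\<^sup>2) * (l * \<bar>x - y\<bar>)"
        by (simp add: C1_eq power2_eq_square algebra_simps)
      also have "\<dots> \<le> 1 * (l * \<bar>x - y\<bar>)"
        using l0 by (intro mult_right_mono) auto
      finally show ?thesis by simp
    qed
    define G where "G x = Pg x + PH x" for x
    have G: "tame l G"
      unfolding tame_def using Pg01 lip by (intro exI[of _ Pg] exI[of _ PH]) (auto simp: G_def fun_eq_iff)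
    have int_tame: "integrable (stationary \<alpha> \<mu> \<sigma>) F" if "tame l F" for F
      unfolding stationary_def
      by (rule integrable_gauss_coarse_lipschitz[OF stationary_sd_pos[OF \<alpha> \<sigma>] tame_measurable[OF l0 that] tame_diff_le[OF that]])
    have int_Pg: "integrable (stationary \<alpha> \<mu> \<sigma>) Pg"
      using Pg01 by (intro S.integrable_const_bound[where B = 1]) auto
    have int_PH: "integrable (stationary \<alpha> \<mu> \<sigma>) PH"
      using Bochner_Integration.integrable_diff[OF int_tame[OF G] int_Pg] by (simp add: G_def)
    have "(\<integral>x. G x \<partial>stationary \<alpha> \<mu> \<sigma>) = (\<integral>x. Pg x \<partial>stationary \<alpha> \<mu> \<sigma>) + (\<integral>x. PH x \<partial>stationary \<alpha> \<mu> \<sigma>)"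
      unfolding G_def by (rule Bochner_Integration.integral_add[OF int_Pg int_PH])
    also have "\<dots> = stationary_mean \<alpha> \<mu> \<sigma> g + (\<integral>x. H x \<partial>stationary \<alpha> \<mu> \<sigma>)"
      unfolding PH_def integral_stationary_step[OF \<alpha> \<sigma> int_tame[OF \<open>tame l H\<close>]]
      by (simp add: stationary_mean_def Pg_def)
    finally have mean: "(\<integral>x. G x \<partial>stationary \<alpha> \<mu> \<sigma>) = stationary_mean \<alpha> \<mu> \<sigma> g + (\<integral>x. H x \<partial>stationary \<alpha> \<mu> \<sigma>)" .
    have mgf: "(\<integral>\<^sup>+e. ennreal (exp (k * (g x (\<alpha> * x + e) + H (\<alpha> * x + e)))) \<partial>gauss \<mu> \<sigma>) \<le> ennreal (exp (k * G x + C * k\<^sup>2))"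
      if k: "0 \<le> k" "k \<le> 1" for k x
    proof -
      let ?F = "\<lambda>e. g x (\<alpha> * x + e) + H (\<alpha> * x + e)"
      have "\<bar>?F e - ?F e'\<bar> \<le> 2 + l * \<bar>e - e'\<bar>" for e e'
        using g[of x "\<alpha> * x + e"] g[of x "\<alpha> * x + e'"]
          tame_diff_le[OF \<open>tame l H\<close>, of "\<alpha> * x + e" "\<alpha> * x + e'"] by simp linarith
      from C(2)[of ?F, OF _ this k]
      have "(\<integral>\<^sup>+e. ennreal (exp (k * ?F e)) \<partial>gauss \<mu> \<sigma>) \<le> ennreal (exp (k * (\<integral>e. ?F e \<partial>gauss \<mu> \<sigma>) + C * k\<^sup>2))"
        by simp
      moreover have "(\<integral>e. ?F e \<partial>gauss \<mu> \<sigma>) = G x"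
        unfolding G_def Pg_def PH_def H using int_g int_B int_L by simp
      ultimately show ?thesis by simp
    qed
    show "\<exists>G. tame l G \<and>
       (\<integral>x. G x \<partial>stationary \<alpha> \<mu> \<sigma>) = stationary_mean \<alpha> \<mu> \<sigma> g + (\<integral>x. H x \<partial>stationary \<alpha> \<mu> \<sigma>) \<and>
       (\<forall>k x. 0 \<le> k \<longrightarrow> k \<le> 1 \<longrightarrow>
          (\<integral>\<^sup>+e. ennreal (exp (k * (g x (\<alpha> * x + e) + H (\<alpha> * x + e)))) \<partial>gauss \<mu> \<sigma>) \<le>
            ennreal (exp (k * G x + C * k\<^sup>2)))"
      using G mean mgf by blast
  qed
qed

lemma exp_markov_inequality:
  assumes "prob_space M" and [measurable]: "S \<in> borel_measurable M"
    and le: "(\<integral>\<^sup>+\<omega>. ennreal (exp (S \<omega>)) \<partial>M) \<le> ennreal (exp v)"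
  shows "measure M {\<omega> \<in> space M. t \<le> S \<omega>} \<le> exp (v - t)"
proof -
  interpret prob_space M by fact
  have "emeasure M {\<omega> \<in> space M. t \<le> S \<omega>} = (\<integral>\<^sup>+\<omega>. indicator {\<omega> \<in> space M. t \<le> S \<omega>} \<omega> \<partial>M)"
    by simp
  also have "\<dots> \<le> (\<integral>\<^sup>+\<omega>. ennreal (exp (- t)) * ennreal (exp (S \<omega>)) \<partial>M)"
    by (intro nn_integral_mono) (auto simp: indicator_def simp flip: ennreal_mult' exp_add)
  also have "\<dots> = ennreal (exp (- t)) * (\<integral>\<^sup>+\<omega>. ennreal (exp (S \<omega>)) \<partial>M)"
    by (rule nn_integral_cmult) measurable
  also have "\<dots> \<le> ennreal (exp (- t)) * ennreal (exp v)"
    using le by (rule mult_left_mono) simp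
  also have "\<dots> = ennreal (exp (v - t))"
    by (simp flip: ennreal_mult' exp_add)
  finally show ?thesis
    by (simp add: emeasure_eq_measure)
qed

text \<open>Running \<open>tame_step\<close> backwards from \<open>H = 0\<close> leaves a tame function evaluated at the starting point \<open>0\<close>,
  which differs from its stationary mean by at most \<open>D\<close>, whatever \<open>n\<close> is.\<close>

lemma exp_moment_additive_functional:
  assumes \<alpha>: "0 \<le> \<alpha>" "\<alpha> < 1" and \<sigma>: "0 < \<sigma>"
  obtains C D where "0 < C"
    "\<And>g n k. case_prod g \<in> borel_measurable (borel \<Otimes>\<^sub>M borel) \<Longrightarrow> (\<And>x y. 0 \<le> g x y \<and> g x y \<le> 1) \<Longrightarrow>
       0 \<le> k \<Longrightarrow> k \<le> 1 \<Longrightarrow>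
       path_expect \<alpha> (gauss \<mu> \<sigma>) (\<lambda>_ x y. ennreal (exp (k * g x y))) n (\<lambda>_. 1) \<le>
         ennreal (exp (real n * (k * stationary_mean \<alpha> \<mu> \<sigma> g + C * k\<^sup>2) + k * D))"
proof -
  interpret S: prob_space "stationary \<alpha> \<mu> \<sigma>" using assms by (rule prob_space_stationary)
  show thesis
  proof (rule tame_step[OF assms, of \<mu>])
    fix l C assume l: "0 \<le> l" and C: "0 < C" and step:
      "\<And>g H. case_prod g \<in> borel_measurable (borel \<Otimes>\<^sub>M borel) \<Longrightarrow> (\<And>x y. 0 \<le> g x y \<and> g x y \<le> 1) \<Longrightarrow>
         tame l H \<Longrightarrow> \<exists>G. tame l G \<and>
         (\<integral>x. G x \<partial>stationary \<alpha> \<mu> \<sigma>) = stationary_mean \<alpha> \<mu> \<sigma> g + (\<integral>x. H x \<partial>stationary \<alpha> \<mu> \<sigma>) \<and>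
         (\<forall>k x. 0 \<le> k \<longrightarrow> k \<le> 1 \<longrightarrow>
            (\<integral>\<^sup>+e. ennreal (exp (k * (g x (\<alpha> * x + e) + H (\<alpha> * x + e)))) \<partial>gauss \<mu> \<sigma>) \<le>
              ennreal (exp (k * G x + C * k\<^sup>2)))"
    have intabs: "integrable (stationary \<alpha> \<mu> \<sigma>) (\<lambda>x. \<bar>x\<bar>)"
      unfolding stationary_def by (intro integrable_gauss_abs stationary_sd_pos assms)
    define D where "D = 1 + l * (\<integral>x. \<bar>x\<bar> \<partial>stationary \<alpha> \<mu> \<sigma>)"
    have start: "H 0 \<le> (\<integral>x. H x \<partial>stationary \<alpha> \<mu> \<sigma>) + D" if "tame l H" for H
    proof -
      have intH: "integrable (stationary \<alpha> \<mu> \<sigma>) H"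
        unfolding stationary_def
        by (rule integrable_gauss_coarse_lipschitz[OF stationary_sd_pos[OF assms] tame_measurable[OF l that] tame_diff_le[OF that]])
      have "H 0 = (\<integral>x. H 0 \<partial>stationary \<alpha> \<mu> \<sigma>)" using S.prob_space by simp
      also have "\<dots> \<le> (\<integral>x. H x + (1 + l * \<bar>x\<bar>) \<partial>stationary \<alpha> \<mu> \<sigma>)"
      proof (rule integral_mono)
        show "H 0 \<le> H x + (1 + l * \<bar>x\<bar>)" for x
          using tame_diff_le[OF that, of 0 x] by simp
      qed (use intH intabs in auto)
      also have "\<dots> = (\<integral>x. H x \<partial>stationary \<alpha> \<mu> \<sigma>) + D"
        using intH intabs S.prob_space by (simp add: D_def)
      finally show ?thesis .
    qed
    show thesis
    proof (rule that[OF C, of D])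
      fix g :: "real \<Rightarrow> real \<Rightarrow> real" and n :: nat and k :: real
      assume g[measurable]: "case_prod g \<in> borel_measurable (borel \<Otimes>\<^sub>M borel)" and g01: "\<And>x y. 0 \<le> g x y \<and> g x y \<le> 1"
        and k: "0 \<le> k" "k \<le> 1"
      let ?f = "\<lambda>_ x y. ennreal (exp (k * g x y))" and ?m = "stationary_mean \<alpha> \<mu> \<sigma> g"
      have f[measurable]: "case_prod (?f i) \<in> borel_measurable (borel \<Otimes>\<^sub>M borel)" for i :: nat
        unfolding case_prod_beta' by measurable
      have "path_expect \<alpha> (gauss \<mu> \<sigma>) ?f n (\<lambda>x. ennreal (exp (k * H x))) \<le>
          ennreal (exp (real n * (k * ?m + C * k\<^sup>2) + k * ((\<integral>x. H x \<partial>stationary \<alpha> \<mu> \<sigma>) + D)))"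
        if "tame l H" for H
        using that
      proof (induction n arbitrary: H)
        case 0
        then show ?case using start[of H] k by (simp add: mult_left_mono)
      next
        case (Suc n)
        obtain G where G: "tame l G" and mean: "(\<integral>x. G x \<partial>stationary \<alpha> \<mu> \<sigma>) = ?m + (\<integral>x. H x \<partial>stationary \<alpha> \<mu> \<sigma>)"
          and mgf: "\<And>x. (\<integral>\<^sup>+e. ennreal (exp (k * (g x (\<alpha> * x + e) + H (\<alpha> * x + e)))) \<partial>gauss \<mu> \<sigma>) \<le>
              ennreal (exp (k * G x + C * k\<^sup>2))"
          using step[OF g g01 Suc.prems] k by blast
        have [measurable]: "G \<in> borel_measurable borel" by (rule tame_measurable[OF l G])
        have "path_expect \<alpha> (gauss \<mu> \<sigma>) ?f (Suc n) (\<lambda>x. ennreal (exp (k * H x))) \<le>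
            path_expect \<alpha> (gauss \<mu> \<sigma>) ?f n (\<lambda>x. ennreal (exp (C * k\<^sup>2)) * ennreal (exp (k * G x)))"
          unfolding path_expect.simps
        proof (rule path_expect_mono)
          fix x
          show "(\<integral>\<^sup>+e. ennreal (exp (k * g x (\<alpha> * x + e))) * ennreal (exp (k * H (\<alpha> * x + e))) \<partial>gauss \<mu> \<sigma>) \<le>
              ennreal (exp (C * k\<^sup>2)) * ennreal (exp (k * G x))"
            using mgf[of x] by (simp add: distrib_left exp_add ennreal_mult' mult.commute)
        qed
        also have "\<dots> = ennreal (exp (C * k\<^sup>2)) * path_expect \<alpha> (gauss \<mu> \<sigma>) ?f n (\<lambda>x. ennreal (exp (k * G x)))"
          by (rule path_expect_cmult[OF sets_gauss prob_space_gauss[OF \<sigma>] f]) measurable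
        also have "\<dots> \<le> ennreal (exp (C * k\<^sup>2)) *
            ennreal (exp (real n * (k * ?m + C * k\<^sup>2) + k * ((\<integral>x. G x \<partial>stationary \<alpha> \<mu> \<sigma>) + D)))"
          by (intro mult_left_mono Suc.IH G) simp
        also have "\<dots> = ennreal (exp (real (Suc n) * (k * ?m + C * k\<^sup>2) + k * ((\<integral>x. H x \<partial>stationary \<alpha> \<mu> \<sigma>) + D)))"
          by (simp add: mean algebra_simps flip: ennreal_mult' exp_add)
        finally show ?case .
      qed
      from this[of "\<lambda>_. 0"] show "path_expect \<alpha> (gauss \<mu> \<sigma>) ?f n (\<lambda>_. 1) \<le>
          ennreal (exp (real n * (k * ?m + C * k\<^sup>2) + k * D))"
        using l by (simp add: tame_def exI[of _ "\<lambda>_. 0"])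
    qed
  qed
qed

lemma nn_integral_exp_sum_path:
  assumes M: "prob_space M" "iid_normal M \<mu> \<sigma> \<epsilon>" and \<sigma>: "0 < \<sigma>"
    and g[measurable]: "case_prod g \<in> borel_measurable (borel \<Otimes>\<^sub>M borel)"
  shows "(\<integral>\<^sup>+\<omega>. ennreal (exp (k * (\<Sum>i<n. g (state \<alpha> (\<lambda>i. \<epsilon> i \<omega>) i) (state \<alpha> (\<lambda>i. \<epsilon> i \<omega>) (Suc i))))) \<partial>M) =
    path_expect \<alpha> (gauss \<mu> \<sigma>) (\<lambda>_ x y. ennreal (exp (k * g x y))) n (\<lambda>_. 1)"
proof -
  have f: "case_prod (\<lambda>x y. ennreal (exp (k * g x y))) \<in> borel_measurable (borel \<Otimes>\<^sub>M borel)"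
    unfolding case_prod_beta' by measurable
  have "(\<integral>\<^sup>+\<omega>. ennreal (exp (k * (\<Sum>i<n. g (state \<alpha> (\<lambda>i. \<epsilon> i \<omega>) i) (state \<alpha> (\<lambda>i. \<epsilon> i \<omega>) (Suc i))))) \<partial>M) =
     (\<integral>\<^sup>+\<omega>. (\<Prod>i<n. ennreal (exp (k * g (state \<alpha> (\<lambda>i. \<epsilon> i \<omega>) i) (state \<alpha> (\<lambda>i. \<epsilon> i \<omega>) (Suc i))))) * 1 \<partial>M)"
    by (simp add: sum_distrib_left exp_sum prod_ennreal del: state.simps)
  also have "\<dots> = path_expect \<alpha> (gauss \<mu> \<sigma>) (\<lambda>_ x y. ennreal (exp (k * g x y))) n (\<lambda>_. 1)"
    by (rule nn_integral_path[OF M \<sigma> f]) simp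
  finally show ?thesis .
qed

lemma iid_normal_measurable: "iid_normal M \<mu> \<sigma> \<epsilon> \<Longrightarrow> \<epsilon> i \<in> borel_measurable M"
  by (simp add: iid_normal_def distributed_gauss)

text \<open>The Chernoff bound. The exponent per step is \<open>C k\<^sup>2 - k \<delta>\<close>, negative for small \<open>k\<close>. Applied to \<open>1 - g\<close>
  it also controls deviations downwards.\<close>

lemma additive_functional_concentration:
  assumes M: "prob_space M" "iid_normal M \<mu> \<sigma> \<epsilon>" and \<alpha>: "0 \<le> \<alpha>" "\<alpha> < 1" and \<sigma>: "0 < \<sigma>"
    and g[measurable]: "case_prod g \<in> borel_measurable (borel \<Otimes>\<^sub>M borel)" and g01: "\<And>x y. 0 \<le> g x y \<and> g x y \<le> 1"
    and \<delta>: "0 < \<delta>"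
  obtains c D where "0 < c"
    "\<forall>n. measure M {\<omega> \<in> space M. real n * (stationary_mean \<alpha> \<mu> \<sigma> g + \<delta>) \<le>
        (\<Sum>i<n. g (state \<alpha> (\<lambda>i. \<epsilon> i \<omega>) i) (state \<alpha> (\<lambda>i. \<epsilon> i \<omega>) (Suc i)))} \<le> exp (D - c * real n)"
proof -
  note [measurable] = iid_normal_measurable[OF M(2)]
  obtain C D where C: "0 < C" and bound:
    "\<And>g n k. case_prod g \<in> borel_measurable (borel \<Otimes>\<^sub>M borel) \<Longrightarrow> (\<And>x y. 0 \<le> g x y \<and> g x y \<le> 1) \<Longrightarrow>
       0 \<le> k \<Longrightarrow> k \<le> 1 \<Longrightarrow>
       path_expect \<alpha> (gauss \<mu> \<sigma>) (\<lambda>_ x y. ennreal (exp (k * g x y))) n (\<lambda>_. 1) \<le>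
         ennreal (exp (real n * (k * stationary_mean \<alpha> \<mu> \<sigma> g + C * k\<^sup>2) + k * D))"
    using exp_moment_additive_functional[OF \<alpha> \<sigma>, of \<mu>] by metis
  define k where "k = min 1 (\<delta> / (2 * C))"
  have k: "0 < k" "k \<le> 1" and Ck: "C * k \<le> \<delta> / 2"
    using C \<delta> by (auto simp: k_def min_def field_simps)
  let ?S = "\<lambda>n \<omega>. \<Sum>i<n. g (state \<alpha> (\<lambda>i. \<epsilon> i \<omega>) i) (state \<alpha> (\<lambda>i. \<epsilon> i \<omega>) (Suc i))"
  show thesis
  proof (rule that[of "k * \<delta> / 2" "k * D"])
    show "0 < k * \<delta> / 2" using k \<delta> by simp
    show "\<forall>n. measure M {\<omega> \<in> space M. real n * (stationary_mean \<alpha> \<mu> \<sigma> g + \<delta>) \<le> ?S n \<omega>} \<le> exp (k * D - k * \<delta> / 2 * real n)"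
    proof
      fix n
      let ?m = "stationary_mean \<alpha> \<mu> \<sigma> g"
      have S: "?S n \<in> borel_measurable M" by (simp del: state.simps)
      have "measure M {\<omega> \<in> space M. k * (real n * (?m + \<delta>)) \<le> k * ?S n \<omega>} \<le>
          exp ((real n * (k * ?m + C * k\<^sup>2) + k * D) - k * (real n * (?m + \<delta>)))"
      proof (rule exp_markov_inequality[OF M(1)])
        show "(\<lambda>\<omega>. k * ?S n \<omega>) \<in> borel_measurable M" using S by simp
        show "(\<integral>\<^sup>+\<omega>. ennreal (exp (k * ?S n \<omega>)) \<partial>M) \<le> ennreal (exp (real n * (k * ?m + C * k\<^sup>2) + k * D))"
          unfolding nn_integral_exp_sum_path[OF M \<sigma> g] using k by (intro bound g g01) auto
      qed
      also have "(real n * (k * ?m + C * k\<^sup>2) + k * D) - k * (real n * (?m + \<delta>)) = k * D + real n * (k * (C * k - \<delta>))"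
        by (simp add: power2_eq_square algebra_simps)
      also have "exp \<dots> \<le> exp (k * D - k * \<delta> / 2 * real n)"
      proof -
        have "real n * (k * (C * k - \<delta>)) \<le> real n * (k * (- \<delta> / 2))"
          using Ck k by (intro mult_left_mono) auto
        then show ?thesis by (simp add: mult_ac)
      qed
      finally show "measure M {\<omega> \<in> space M. real n * (?m + \<delta>) \<le> ?S n \<omega>} \<le> exp (k * D - k * \<delta> / 2 * real n)"
        using k(1) by (simp del: state.simps)
    qed
  qed
qed

section \<open>Linear growth of the sum of squares\<close>

text \<open>Since \<open>(\<alpha>x + e)\<^sup>2 \<le> \<alpha> x\<^sup>2 + e\<^sup>2 / (1 - \<alpha>)\<close> by convexity, the function \<open>x \<mapsto> exp (a \<alpha> x\<^sup>2)\<close> grows by at most a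
  constant factor \<open>C\<close> in every step, even after multiplication by \<open>exp (\<eta> x\<^sup>2)\<close> with
  \<open>\<eta> = a (1 - \<alpha>)\<close>. Thus the sum of squares has an exponential moment that is at most \<open>C\<^sup>n\<close>.\<close>

lemma sum_squares_linear_growth:
  assumes M: "prob_space M" "iid_normal M \<mu> \<sigma> \<epsilon>" and \<alpha>: "0 \<le> \<alpha>" "\<alpha> < 1" and \<sigma>: "0 < \<sigma>"
  obtains K where
    "\<forall>n. measure M {\<omega> \<in> space M. K * real n \<le> (\<Sum>i<n. (state \<alpha> (\<lambda>i. \<epsilon> i \<omega>) (Suc i))\<^sup>2)} \<le> exp (- real n)"
proof -
  note [measurable] = iid_normal_measurable[OF M(2)]
  interpret N: prob_space "gauss \<mu> \<sigma>" using \<sigma> by (rule prob_space_gauss)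
  obtain b where b: "0 < b" and int: "integrable (gauss \<mu> \<sigma>) (\<lambda>x. exp (b * x\<^sup>2))"
    using integrable_gauss_exp_square[OF \<sigma>] .
  define a where "a = b * (1 - \<alpha>)"
  define \<eta> where "\<eta> = a * (1 - \<alpha>)"
  have a: "0 < a" and \<eta>: "0 < \<eta>" using b \<alpha> by (auto simp: a_def \<eta>_def)
  define C where "C = (\<integral>x. exp (b * x\<^sup>2) \<partial>gauss \<mu> \<sigma>)"
  have C: "1 \<le> C"
    unfolding C_def using int b by (intro N.integral_ge_const) auto
  let ?f = "\<lambda>_ x y. ennreal (exp (\<eta> * y\<^sup>2))" and ?h = "\<lambda>x. ennreal (exp (a * \<alpha> * x\<^sup>2))"
  have g: "case_prod (\<lambda>x y::real. y\<^sup>2) \<in> borel_measurable (borel \<Otimes>\<^sub>M (borel :: real measure))"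
    unfolding case_prod_beta' by measurable
  have f: "case_prod (?f i) \<in> borel_measurable (borel \<Otimes>\<^sub>M (borel :: real measure))" for i :: nat
    unfolding case_prod_beta' by measurable
  have convex: "a * (\<alpha> * x + e)\<^sup>2 \<le> a * \<alpha> * x\<^sup>2 + b * e\<^sup>2" for x e
  proof -
    have "(1 - \<alpha>) * (\<alpha> * x + e)\<^sup>2 + \<alpha> * ((1 - \<alpha>) * x - e)\<^sup>2 = (1 - \<alpha>) * \<alpha> * x\<^sup>2 + e\<^sup>2"
      by (simp add: power2_eq_square algebra_simps)
    then have "(1 - \<alpha>) * (\<alpha> * x + e)\<^sup>2 \<le> (1 - \<alpha>) * \<alpha> * x\<^sup>2 + e\<^sup>2"
      using \<alpha> zero_le_mult_iff[of \<alpha> "((1 - \<alpha>) * x - e)\<^sup>2"] by (smt (verit) zero_le_power2)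
    then have "b * ((1 - \<alpha>) * (\<alpha> * x + e)\<^sup>2) \<le> b * ((1 - \<alpha>) * \<alpha> * x\<^sup>2 + e\<^sup>2)"
      using b by simp
    then show ?thesis by (simp add: a_def algebra_simps)
  qed
  have step: "(\<integral>\<^sup>+e. ennreal (exp (\<eta> * (\<alpha> * x + e)\<^sup>2)) * ?h (\<alpha> * x + e) \<partial>gauss \<mu> \<sigma>) \<le> ennreal C * ?h x" for x
  proof -
    have "(\<integral>\<^sup>+e. ennreal (exp (\<eta> * (\<alpha> * x + e)\<^sup>2)) * ?h (\<alpha> * x + e) \<partial>gauss \<mu> \<sigma>) \<le>
        (\<integral>\<^sup>+e. ?h x * ennreal (exp (b * e\<^sup>2)) \<partial>gauss \<mu> \<sigma>)"
    proof (rule nn_integral_mono)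
      fix e
      have "\<eta> * (\<alpha> * x + e)\<^sup>2 + a * \<alpha> * (\<alpha> * x + e)\<^sup>2 = a * (\<alpha> * x + e)\<^sup>2"
        by (simp add: \<eta>_def algebra_simps)
      then show "ennreal (exp (\<eta> * (\<alpha> * x + e)\<^sup>2)) * ?h (\<alpha> * x + e) \<le> ?h x * ennreal (exp (b * e\<^sup>2))"
        using convex[of x e] by (simp flip: ennreal_mult' exp_add)
    qed
    also have "\<dots> = ?h x * (\<integral>\<^sup>+e. ennreal (exp (b * e\<^sup>2)) \<partial>gauss \<mu> \<sigma>)"
      by (rule nn_integral_cmult) measurable
    also have "\<dots> = ?h x * ennreal C"
      unfolding C_def using int by (subst nn_integral_eq_integral) auto
    finally show ?thesis by (simp add: mult.commute)
  qed
  have growth: "path_expect \<alpha> (gauss \<mu> \<sigma>) ?f n ?h \<le> ennreal (C ^ n)" for n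
  proof (induction n)
    case (Suc n)
    have "path_expect \<alpha> (gauss \<mu> \<sigma>) ?f (Suc n) ?h \<le> path_expect \<alpha> (gauss \<mu> \<sigma>) ?f n (\<lambda>x. ennreal C * ?h x)"
      unfolding path_expect.simps by (rule path_expect_mono) (rule step)
    also have "\<dots> = ennreal C * path_expect \<alpha> (gauss \<mu> \<sigma>) ?f n ?h"
      by (rule path_expect_cmult[OF sets_gauss N.prob_space_axioms f]) measurable
    also have "\<dots> \<le> ennreal C * ennreal (C ^ n)" by (intro mult_left_mono Suc.IH) simp
    finally show ?case using C by (simp flip: ennreal_mult')
  qed simp
  show thesis
  proof (rule that[of "(ln C + 1) / \<eta>"], rule allI)
    fix n
    let ?S = "\<lambda>\<omega>. \<Sum>i<n. (state \<alpha> (\<lambda>i. \<epsilon> i \<omega>) (Suc i))\<^sup>2"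
    let ?t = "real n * (ln C + 1)"
    have "measure M {\<omega> \<in> space M. ?t \<le> \<eta> * ?S \<omega>} \<le> exp (real n * ln C - ?t)"
    proof (rule exp_markov_inequality[OF M(1)])
      show "(\<lambda>\<omega>. \<eta> * ?S \<omega>) \<in> borel_measurable M" by (simp del: state.simps)
      have "(\<integral>\<^sup>+\<omega>. ennreal (exp (\<eta> * ?S \<omega>)) \<partial>M) = path_expect \<alpha> (gauss \<mu> \<sigma>) ?f n (\<lambda>_. 1)"
        by (rule nn_integral_exp_sum_path[OF M \<sigma> g])
      also have "\<dots> \<le> path_expect \<alpha> (gauss \<mu> \<sigma>) ?f n ?h"
        using a \<alpha> by (intro path_expect_mono) simp
      also have "\<dots> \<le> ennreal (C ^ n)" by (rule growth)
      also have "C ^ n = exp (real n * ln C)"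
        using C by (simp add: exp_of_nat_mult)
      finally show "(\<integral>\<^sup>+\<omega>. ennreal (exp (\<eta> * ?S \<omega>)) \<partial>M) \<le> ennreal (exp (real n * ln C))" .
    qed
    also have "real n * ln C - ?t = - real n" by (simp add: algebra_simps)
    finally show "measure M {\<omega> \<in> space M. (ln C + 1) / \<eta> * real n \<le> ?S \<omega>} \<le> exp (- real n)"
      using \<eta> by (simp add: field_simps del: state.simps)
  qed
qed

section \<open>The likelihood as a function of the parameter\<close>

lemma nn_integral_gauss_shift:
  assumes [measurable]: "F \<in> borel_measurable borel"
  shows "(\<integral>\<^sup>+e. F (a + e) \<partial>gauss \<mu> \<sigma>) = (\<integral>\<^sup>+y. ennreal (normal_density \<mu> \<sigma> (y - a)) * F y \<partial>lborel)"
proof -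
  have "(\<integral>\<^sup>+e. F (a + e) \<partial>gauss \<mu> \<sigma>) = (\<integral>\<^sup>+e. ennreal (normal_density \<mu> \<sigma> e) * F (a + e) \<partial>lborel)"
    unfolding gauss_def by (rule nn_integral_density) measurable
  also have "\<dots> = (\<integral>\<^sup>+y. ennreal (normal_density \<mu> \<sigma> (y - a)) * F y \<partial>lborel)"
    by (subst nn_integral_real_affine[where c = 1 and t = "- a"]) auto
  finally show ?thesis .
qed

text \<open>Domination of transition densities is only required on the support of \<open>f\<close>. For the likelihood this
  support is a pair of bounded cells, although the ratio of the two densities is unbounded.\<close>

lemma path_expect_kernel_le:
  assumes \<sigma>: "0 < \<sigma>" "0 < \<sigma>'"
    and f: "\<And>i. case_prod (f i) \<in> borel_measurable (borel \<Otimes>\<^sub>M borel)"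
    and h: "h \<in> borel_measurable borel"
    and le: "\<And>i x y. f i x y \<noteq> 0 \<Longrightarrow>
      normal_density \<mu> \<sigma> (y - \<alpha> * x) \<le> exp (c i) * normal_density \<mu>' \<sigma>' (y - \<alpha>' * x)"
  shows "path_expect \<alpha> (gauss \<mu> \<sigma>) f n h \<le> ennreal (exp (\<Sum>i<n. c i)) * path_expect \<alpha>' (gauss \<mu>' \<sigma>') f n h"
  using h
proof (induction n arbitrary: h)
  case (Suc n)
  note [measurable] = f Suc.prems
  let ?K = "\<lambda>\<alpha> \<mu> \<sigma> x. \<integral>\<^sup>+e. f n x (\<alpha> * x + e) * h (\<alpha> * x + e) \<partial>gauss \<mu> \<sigma>"
  have m: "?K \<alpha>' \<mu>' \<sigma>' \<in> borel_measurable borel"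
    by (rule measurable_path_step[OF sets_gauss prob_space_gauss[OF \<sigma>(2)] f Suc.prems])
  have "?K \<alpha> \<mu> \<sigma> x \<le> ennreal (exp (c n)) * ?K \<alpha>' \<mu>' \<sigma>' x" for x
  proof -
    have [measurable]: "(\<lambda>y. f n x y * h y) \<in> borel_measurable borel" by measurable
    have "?K \<alpha> \<mu> \<sigma> x = (\<integral>\<^sup>+y. ennreal (normal_density \<mu> \<sigma> (y - \<alpha> * x)) * (f n x y * h y) \<partial>lborel)"
      by (rule nn_integral_gauss_shift) measurable
    also have "\<dots> \<le> (\<integral>\<^sup>+y. ennreal (exp (c n)) * (ennreal (normal_density \<mu>' \<sigma>' (y - \<alpha>' * x)) * (f n x y * h y)) \<partial>lborel)"
    proof (rule nn_integral_mono)
      fix y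
      show "ennreal (normal_density \<mu> \<sigma> (y - \<alpha> * x)) * (f n x y * h y) \<le>
          ennreal (exp (c n)) * (ennreal (normal_density \<mu>' \<sigma>' (y - \<alpha>' * x)) * (f n x y * h y))"
      proof (cases "f n x y = 0")
        case False
        from le[OF this] show ?thesis
          unfolding mult.assoc[symmetric] ennreal_mult'[OF exp_ge_zero, symmetric]
          by (intro mult_right_mono ennreal_leI) auto
      qed simp
    qed
    also have "\<dots> = ennreal (exp (c n)) * (\<integral>\<^sup>+y. ennreal (normal_density \<mu>' \<sigma>' (y - \<alpha>' * x)) * (f n x y * h y) \<partial>lborel)"
      by (rule nn_integral_cmult) measurable
    also have "(\<integral>\<^sup>+y. ennreal (normal_density \<mu>' \<sigma>' (y - \<alpha>' * x)) * (f n x y * h y) \<partial>lborel) = ?K \<alpha>' \<mu>' \<sigma>' x"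
      by (rule nn_integral_gauss_shift[symmetric]) measurable
    finally show ?thesis .
  qed
  then have "path_expect \<alpha> (gauss \<mu> \<sigma>) f (Suc n) h \<le>
      path_expect \<alpha> (gauss \<mu> \<sigma>) f n (\<lambda>x. ennreal (exp (c n)) * ?K \<alpha>' \<mu>' \<sigma>' x)"
    unfolding path_expect.simps by (rule path_expect_mono)
  also have "\<dots> = ennreal (exp (c n)) * path_expect \<alpha> (gauss \<mu> \<sigma>) f n (?K \<alpha>' \<mu>' \<sigma>')"
    by (rule path_expect_cmult[OF sets_gauss prob_space_gauss[OF \<sigma>(1)] f m])
  also have "\<dots> \<le> ennreal (exp (c n)) *
      (ennreal (exp (\<Sum>i<n. c i)) * path_expect \<alpha>' (gauss \<mu>' \<sigma>') f n (?K \<alpha>' \<mu>' \<sigma>'))"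
    by (intro mult_left_mono Suc.IH m) simp
  also have "\<dots> = ennreal (exp (\<Sum>i<Suc n. c i)) * path_expect \<alpha>' (gauss \<mu>' \<sigma>') f (Suc n) h"
    by (simp add: exp_add ennreal_mult' ac_simps)
  finally show ?case .
qed simp

text \<open>The coefficients of the logarithm of \<open>normal_density \<mu> \<sigma> (y - \<alpha> x)\<close> with respect to the monomials
  \<open>1\<close>, \<open>y\<close>, \<open>x\<close>, \<open>y\<^sup>2\<close>, \<open>x y\<close>, \<open>x\<^sup>2\<close>.\<close>

definition log_density_coeffs :: "param \<Rightarrow> real list" where
  "log_density_coeffs \<theta> = (let \<alpha> = fst \<theta>; \<mu> = fst (snd \<theta>); \<sigma> = snd (snd \<theta>); \<tau> = 1 / (2 * \<sigma>\<^sup>2) in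
     [- ln (sqrt (2 * pi * \<sigma>\<^sup>2)) - \<tau> * \<mu>\<^sup>2, 2 * \<tau> * \<mu>, - 2 * \<tau> * \<alpha> * \<mu>, - \<tau>, 2 * \<tau> * \<alpha>, - \<tau> * \<alpha>\<^sup>2])"

definition log_density_gap :: "param \<Rightarrow> param \<Rightarrow> real" where
  "log_density_gap \<theta> \<theta>' =
     sum_list (map2 (\<lambda>a b. \<bar>a - b\<bar>) (log_density_coeffs \<theta>) (log_density_coeffs \<theta>'))"

lemma log_density_gap_self: "log_density_gap \<theta> \<theta> = 0"
  by (simp add: log_density_gap_def log_density_coeffs_def Let_def)

lemma log_density_gap_nonneg: "0 \<le> log_density_gap \<theta> \<theta>'"
  by (simp add: log_density_gap_def log_density_coeffs_def Let_def)

lemma isCont_log_density_gap: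
  assumes "0 < snd (snd \<theta>)"
  shows "isCont (\<lambda>\<theta>'. log_density_gap \<theta>' \<theta>) \<theta>"
  unfolding log_density_gap_def log_density_coeffs_def Let_def
  using assms by (simp, intro continuous_intros) (auto simp: real_sqrt_eq_zero_cancel_iff)

text \<open>Each of the six monomials is bounded by \<open>1 + x\<^sup>2 + y\<^sup>2\<close>.\<close>

lemma normal_density_ratio:
  assumes "0 < \<sigma>" "0 < \<sigma>'"
  shows "normal_density \<mu> \<sigma> (y - \<alpha> * x) \<le>
    exp (log_density_gap (\<alpha>, \<mu>, \<sigma>) (\<alpha>', \<mu>', \<sigma>') * (1 + x\<^sup>2 + y\<^sup>2)) * normal_density \<mu>' \<sigma>' (y - \<alpha>' * x)"
proof -
  define p where "p \<theta> = sum_list (map2 (*) (log_density_coeffs \<theta>) [1, y, x, y\<^sup>2, x * y, x\<^sup>2])" for \<theta>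
  have dens: "normal_density \<mu> \<sigma> (y - \<alpha> * x) = exp (p (\<alpha>, \<mu>, \<sigma>))" if "0 < \<sigma>" for \<alpha> \<mu> \<sigma> :: real
  proof -
    define \<tau> where "\<tau> = 1 / (2 * \<sigma>\<^sup>2)"
    have "- (y - \<alpha> * x - \<mu>)\<^sup>2 / (2 * \<sigma>\<^sup>2) = - \<tau> * (y - \<alpha> * x - \<mu>)\<^sup>2"
      by (simp add: \<tau>_def)
    also have "\<dots> = p (\<alpha>, \<mu>, \<sigma>) + ln (sqrt (2 * pi * \<sigma>\<^sup>2))"
      unfolding p_def log_density_coeffs_def Let_def fst_conv snd_conv \<tau>_def[symmetric]
      by (simp add: power2_eq_square algebra_simps)
    finally have "normal_density \<mu> \<sigma> (y - \<alpha> * x) = 1 / sqrt (2 * pi * \<sigma>\<^sup>2) * (exp (p (\<alpha>, \<mu>, \<sigma>)) * sqrt (2 * pi * \<sigma>\<^sup>2))"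
      using that by (simp add: normal_density_def exp_add)
    then show ?thesis using that by simp
  qed
  have am: "2 * (\<bar>a\<bar> * \<bar>b\<bar>) \<le> a\<^sup>2 + b\<^sup>2" for a b :: real
    using zero_le_power2[of "\<bar>a\<bar> - \<bar>b\<bar>"] by (simp only: power2_diff power2_abs)
  define Q where "Q = 1 + x\<^sup>2 + y\<^sup>2"
  have term_le: "a * v - b * v \<le> \<bar>a - b\<bar> * Q" if "\<bar>v\<bar> \<le> Q" for a b v
  proof -
    have "a * v - b * v = (a - b) * v" by (rule left_diff_distrib[symmetric])
    also have "\<dots> \<le> \<bar>a - b\<bar> * \<bar>v\<bar>" by (metis abs_ge_self abs_mult)
    also have "\<dots> \<le> \<bar>a - b\<bar> * Q" using that by (rule mult_left_mono) simp
    finally show ?thesis .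
  qed
  have v: "\<bar>1\<bar> \<le> Q" "\<bar>y\<bar> \<le> Q" "\<bar>x\<bar> \<le> Q" "\<bar>y\<^sup>2\<bar> \<le> Q" "\<bar>x * y\<bar> \<le> Q" "\<bar>x\<^sup>2\<bar> \<le> Q"
  proof -
    have "0 \<le> x\<^sup>2" "0 \<le> y\<^sup>2" "0 \<le> \<bar>x\<bar>" "0 \<le> \<bar>y\<bar>" by simp_all
    moreover have "2 * \<bar>x\<bar> \<le> 1 + x\<^sup>2" "2 * \<bar>y\<bar> \<le> 1 + y\<^sup>2" "2 * \<bar>x * y\<bar> \<le> x\<^sup>2 + y\<^sup>2"
      using am[of 1 x] am[of 1 y] am[of x y] by (simp_all only: abs_mult abs_one mult_1 one_power2)
    ultimately show "\<bar>1\<bar> \<le> Q" "\<bar>y\<bar> \<le> Q" "\<bar>x\<bar> \<le> Q" "\<bar>y\<^sup>2\<bar> \<le> Q" "\<bar>x * y\<bar> \<le> Q" "\<bar>x\<^sup>2\<bar> \<le> Q"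
      unfolding Q_def abs_power2 by linarith+
  qed
  have "p (\<alpha>, \<mu>, \<sigma>) - p (\<alpha>', \<mu>', \<sigma>') \<le> log_density_gap (\<alpha>, \<mu>, \<sigma>) (\<alpha>', \<mu>', \<sigma>') * Q"
  proof -
    obtain a0 a1 a2 a3 a4 a5 where a: "log_density_coeffs (\<alpha>, \<mu>, \<sigma>) = [a0, a1, a2, a3, a4, a5]"
      by (simp add: log_density_coeffs_def Let_def)
    obtain b0 b1 b2 b3 b4 b5 where b: "log_density_coeffs (\<alpha>', \<mu>', \<sigma>') = [b0, b1, b2, b3, b4, b5]"
      by (simp add: log_density_coeffs_def Let_def)
    show ?thesis
      unfolding p_def log_density_gap_def a b
      using term_le[OF v(1), of a0 b0] term_le[OF v(2), of a1 b1] term_le[OF v(3), of a2 b2]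
        term_le[OF v(4), of a3 b3] term_le[OF v(5), of a4 b4] term_le[OF v(6), of a5 b5]
      by (simp add: distrib_right)
  qed
  then show ?thesis
    unfolding Q_def
    unfolding dens[OF assms(1)] dens[OF assms(2)] by (simp flip: exp_add)
qed

lemma measurable_rounding_off [measurable]: "rounding_off \<in> borel \<rightarrow>\<^sub>M count_space UNIV"
proof -
  have eq: "rounding_off = (\<lambda>x. \<lfloor>x + 1 / 2\<rfloor>)"
    by (simp add: fun_eq_iff rounding_off_eq_round round_def)
  show ?thesis unfolding eq by measurable
qed

definition cell_indicator :: "(nat \<Rightarrow> int) \<Rightarrow> nat \<Rightarrow> real \<Rightarrow> real \<Rightarrow> ennreal" where
  "cell_indicator z i x y = (if rounding_off x = z i \<and> rounding_off y = z (Suc i) then 1 else 0)"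

lemma measurable_cell_indicator: "case_prod (cell_indicator z i) \<in> borel_measurable (borel \<Otimes>\<^sub>M borel)"
  unfolding cell_indicator_def case_prod_beta' by measurable

text \<open>The likelihood of \<open>n\<close> observations, given as \<open>z 1, \<dots>, z n\<close>; the entry \<open>z 0\<close> is the rounding of the
  starting point and has to be \<open>0\<close> for the value to be a probability of the data.\<close>

definition rounded_prob :: "param \<Rightarrow> nat \<Rightarrow> (nat \<Rightarrow> int) \<Rightarrow> ennreal" where
  "rounded_prob \<theta> n z =
     path_expect (fst \<theta>) (gauss (fst (snd \<theta>)) (snd (snd \<theta>))) (cell_indicator z) n (\<lambda>_. 1)"

lemma rounding_off_zero: "rounding_off 0 = 0"
  by (simp add: rounding_off_eq_round)

lemma emeasure_rounded_path:
  assumes M: "prob_space M" "iid_normal M \<mu> \<sigma> \<epsilon>" and \<sigma>: "0 < \<sigma>" and z: "z 0 = 0"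
  shows "emeasure M {\<omega> \<in> space M. \<forall>i<n. rounding_off (state \<alpha> (\<lambda>i. \<epsilon> i \<omega>) (Suc i)) = z (Suc i)} =
    rounded_prob (\<alpha>, \<mu>, \<sigma>) n z"
proof -
  note [measurable] = iid_normal_measurable[OF M(2)]
  let ?A = "{\<omega> \<in> space M. \<forall>i<n. rounding_off (state \<alpha> (\<lambda>i. \<epsilon> i \<omega>) (Suc i)) = z (Suc i)}"
  have [measurable]: "?A \<in> sets M" by measurable
  have eq: "(\<Prod>i<n. cell_indicator z i (state \<alpha> e i) (state \<alpha> e (Suc i))) =
      (if \<forall>i<n. rounding_off (state \<alpha> e (Suc i)) = z (Suc i) then 1 else 0)" for e
  proof (induction n)
    case (Suc n)
    have prev: "rounding_off (state \<alpha> e n) = z n" if "\<forall>i<n. rounding_off (state \<alpha> e (Suc i)) = z (Suc i)"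
      using that z by (cases n) (auto simp: rounding_off_zero simp del: state.simps(2))
    then show ?case
      using Suc by (auto simp: cell_indicator_def less_Suc_eq simp del: state.simps)
  qed simp
  have "emeasure M ?A = (\<integral>\<^sup>+\<omega>. indicator ?A \<omega> \<partial>M)" by simp
  also have "\<dots> = (\<integral>\<^sup>+\<omega>. (\<Prod>i<n. cell_indicator z i (state \<alpha> (\<lambda>i. \<epsilon> i \<omega>) i) (state \<alpha> (\<lambda>i. \<epsilon> i \<omega>) (Suc i))) * 1 \<partial>M)"
    unfolding eq by (intro nn_integral_cong) (simp add: indicator_def del: state.simps)
  also have "\<dots> = rounded_prob (\<alpha>, \<mu>, \<sigma>) n z"
    unfolding rounded_prob_def fst_conv snd_conv
    by (rule nn_integral_path[OF M \<sigma> measurable_cell_indicator]) simp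
  finally show ?thesis .
qed

lemma square_le_of_close:
  fixes a b :: real
  assumes "\<bar>a - b\<bar> \<le> 1 / 2"
  shows "a\<^sup>2 \<le> 2 * b\<^sup>2 + 1 / 2"
proof -
  have "(a - b)\<^sup>2 \<le> (1 / 2)\<^sup>2"
    using assms by (intro abs_le_square_iff[THEN iffD1]) auto
  moreover have "a\<^sup>2 = 2 * b\<^sup>2 + 2 * (a - b)\<^sup>2 - (a - 2 * b)\<^sup>2"
    by (simp add: power2_eq_square algebra_simps)
  moreover have "(1 / 2)\<^sup>2 = (1 / 4 :: real)" by (simp add: power2_eq_square)
  ultimately show ?thesis
    using zero_le_power2[of "a - 2 * b"] by linarith
qed

lemma rounding_off_close: "\<bar>x - real_of_int (rounding_off x)\<bar> \<le> 1 / 2"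
  using rounding_off_eq_iff[of x "rounding_off x"] unfolding atLeastLessThan_iff by linarith

text \<open>Within the cells of \<open>z i\<close> and \<open>z (Suc i)\<close> the bound \<open>1 + x\<^sup>2 + y\<^sup>2\<close> on the monomials turns into a bound
  in terms of the observations, uniformly over the hidden states. In particular a likelihood that is
  positive for one parameter is positive for all of them.\<close>

lemma rounded_prob_ratio:
  assumes "0 < snd (snd \<theta>)" "0 < snd (snd \<theta>')"
  shows "rounded_prob \<theta> n z \<le>
    ennreal (exp (log_density_gap \<theta> \<theta>' * (\<Sum>i<n. 2 + 2 * (real_of_int (z i))\<^sup>2 + 2 * (real_of_int (z (Suc i)))\<^sup>2))) * rounded_prob \<theta>' n z"
proof -
  have sq: "x\<^sup>2 \<le> 2 * (real_of_int (rounding_off x))\<^sup>2 + 1 / 2" for x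
    by (rule square_le_of_close[OF rounding_off_close])
  obtain \<alpha> \<mu> \<sigma> \<alpha>' \<mu>' \<sigma>' where \<theta>: "\<theta> = (\<alpha>, \<mu>, \<sigma>)" "\<theta>' = (\<alpha>', \<mu>', \<sigma>')"
    by (metis prod_cases3)
  have \<sigma>: "0 < \<sigma>" "0 < \<sigma>'" using assms by (simp_all add: \<theta>)
  let ?d = "log_density_gap \<theta> \<theta>'"
  let ?c = "\<lambda>i. ?d * (2 + 2 * (real_of_int (z i))\<^sup>2 + 2 * (real_of_int (z (Suc i)))\<^sup>2)"
  have "path_expect \<alpha> (gauss \<mu> \<sigma>) (cell_indicator z) n (\<lambda>_. 1) \<le>
      ennreal (exp (\<Sum>i<n. ?c i)) * path_expect \<alpha>' (gauss \<mu>' \<sigma>') (cell_indicator z) n (\<lambda>_. 1)"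
  proof (rule path_expect_kernel_le[OF \<sigma> measurable_cell_indicator])
    fix i and x y :: real assume "cell_indicator z i x y \<noteq> 0"
    then have z: "rounding_off x = z i" "rounding_off y = z (Suc i)"
      by (auto simp: cell_indicator_def split: if_splits)
    have "1 + x\<^sup>2 + y\<^sup>2 \<le> 2 + 2 * (real_of_int (z i))\<^sup>2 + 2 * (real_of_int (z (Suc i)))\<^sup>2"
      using sq[of x] sq[of y] unfolding z by simp
    then have "?d * (1 + x\<^sup>2 + y\<^sup>2) \<le> ?c i"
      by (rule mult_left_mono) (rule log_density_gap_nonneg)
    then have "exp (?d * (1 + x\<^sup>2 + y\<^sup>2)) * normal_density \<mu>' \<sigma>' (y - \<alpha>' * x) \<le>
        exp (?c i) * normal_density \<mu>' \<sigma>' (y - \<alpha>' * x)"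
      by (intro mult_right_mono) simp_all
    with normal_density_ratio[OF \<sigma>, of \<mu> y \<alpha> x \<alpha>' \<mu>']
    show "normal_density \<mu> \<sigma> (y - \<alpha> * x) \<le> exp (?c i) * normal_density \<mu>' \<sigma>' (y - \<alpha>' * x)"
      unfolding \<theta> by (rule order_trans)
  qed simp
  then show ?thesis
    unfolding rounded_prob_def \<theta> fst_conv snd_conv sum_distrib_left .
qed

section \<open>Identifiability from two consecutive roundings\<close>

text \<open>Two levels of the distribution function are two linear equations for mean and standard deviation.\<close>

lemma gauss_eq_of_two_quantiles:
  assumes s: "0 < s" "0 < s'" and ab: "a \<noteq> b"
    and a: "measure (gauss m s) {..<a} = measure (gauss m' s') {..<a}"
    and b: "measure (gauss m s) {..<b} = measure (gauss m' s') {..<b}"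
  shows "m = m' \<and> s = s'"
proof -
  have "(a - m) / s = (a - m') / s'" "(b - m) / s = (b - m') / s'"
    using a b unfolding measure_gauss_lessThan[OF s(1)] measure_gauss_lessThan[OF s(2)]
    by (simp_all add: strict_mono_eq[OF strict_mono_std_normal_cdf])
  then have e: "s' * (a - m) = s * (a - m')" "s' * (b - m) = s * (b - m')"
    using s by (simp_all add: field_simps)
  then have "s' * (a - b) = s * (a - b)" by (simp add: algebra_simps)
  then have "s = s'" using ab by simp
  then show ?thesis using e s by simp
qed

lemma stationary_mean_snd:
  assumes \<alpha>: "0 \<le> \<alpha>" "\<alpha> < 1" and \<sigma>: "0 < \<sigma>"
  shows "stationary_mean \<alpha> \<mu> \<sigma> (\<lambda>x y. indicator {..<a} y) = measure (stationary \<alpha> \<mu> \<sigma>) {..<a}"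
proof -
  interpret S: prob_space "stationary \<alpha> \<mu> \<sigma>" using assms by (rule prob_space_stationary)
  have "integrable (stationary \<alpha> \<mu> \<sigma>) (indicator {..<a} :: real \<Rightarrow> real)"
    by (intro S.integrable_const_bound[where B = 1]) (auto simp: indicator_def)
  from integral_stationary_step[OF \<alpha> \<sigma> this] show ?thesis
    by (simp add: stationary_mean_def)
qed

lemma gauss_shifted_lessThan:
  assumes "0 < \<sigma>"
  shows "(\<integral>e. (indicator {..<a} (c + e) :: real) \<partial>gauss \<mu> \<sigma>) = std_normal_cdf ((a - c - \<mu>) / \<sigma>)"
proof -
  have "(\<integral>e. (indicator {..<a} (c + e) :: real) \<partial>gauss \<mu> \<sigma>) = (\<integral>e. indicator {..<a - c} e \<partial>gauss \<mu> \<sigma>)"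
    by (intro Bochner_Integration.integral_cong refl) (auto simp: indicator_def)
  then show ?thesis using measure_gauss_lessThan[OF assms, of \<mu> "a - c"] by simp
qed

text \<open>For a fixed stationary law, the probability that two consecutive states lie below \<open>a\<close> depends on the
  autoregressive coefficient. Let \<open>G x\<close> and \<open>G' x\<close> be the conditional probabilities that the next state
  is below \<open>a\<close>. Both are distribution functions of linear functions of \<open>x\<close> with different slopes, so
  \<open>G' - G\<close> is positive to the left of a single crossing point \<open>x0\<close> and negative to its right, and its
  stationary integral over the whole line vanishes by stationarity. Its integral over \<open>{..<a}\<close> is
  then positive: if \<open>a \<le> x0\<close> the integrand is positive, and otherwise the integral is minus the one
  over \<open>{a..}\<close>, where the integrand is negative.\<close>

lemma stationary_joint_cdf_neq:
  assumes \<alpha>: "0 \<le> \<alpha>" "\<alpha> < \<beta>" "\<beta> < 1" and \<sigma>: "0 < \<sigma>" "0 < \<tau>"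
    and eq: "stationary \<alpha> \<mu> \<sigma> = stationary \<beta> \<nu> \<tau>"
    and sd: "\<sigma> / sqrt (1 - \<alpha>\<^sup>2) = \<tau> / sqrt (1 - \<beta>\<^sup>2)"
  shows "stationary_mean \<alpha> \<mu> \<sigma> (\<lambda>x y. indicator {..<a} x * indicator {..<a} y) \<noteq>
    stationary_mean \<beta> \<nu> \<tau> (\<lambda>x y. indicator {..<a} x * indicator {..<a} y)"
proof
  assume same: "stationary_mean \<alpha> \<mu> \<sigma> (\<lambda>x y. indicator {..<a} x * indicator {..<a} y) =
    stationary_mean \<beta> \<nu> \<tau> (\<lambda>x y. indicator {..<a} x * indicator {..<a} y)"
  have \<alpha>1: "\<alpha> < 1" and \<beta>0: "0 \<le> \<beta>" using \<alpha> by auto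
  let ?S = "stationary \<alpha> \<mu> \<sigma>"
  interpret S: prob_space ?S using \<alpha>(1) \<alpha>1 \<sigma>(1) by (rule prob_space_stationary)
  define G where "G x = std_normal_cdf ((a - \<alpha> * x - \<mu>) / \<sigma>)" for x
  define G' where "G' x = std_normal_cdf ((a - \<beta> * x - \<nu>) / \<tau>)" for x
  have cdf: "0 \<le> std_normal_cdf t" "std_normal_cdf t \<le> 1" for t
    using prob_space.prob_le_1[OF prob_space_gauss[of 1 0]] by (auto simp: std_normal_cdf_def)
  have [measurable]: "std_normal_cdf \<in> borel_measurable borel"
    by (intro borel_measurable_mono strict_mono_mono strict_mono_std_normal_cdf)
  have [measurable]: "G \<in> borel_measurable borel" "G' \<in> borel_measurable borel"
    unfolding G_def G'_def by measurable
  have int: "integrable ?S G" "integrable ?S G'"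
    using cdf by (auto intro!: S.integrable_const_bound[where B = 1] simp: G_def G'_def)
  have intD: "integrable ?S (\<lambda>x. indicator {..<a} x * (G' x - G x))" "integrable ?S (\<lambda>x. G' x - G x)"
    using int by (auto intro!: integrable_real_mult_indicator simp: mult.commute[of "indicator _ _"])
  have mean_G: "(\<integral>x. G x \<partial>?S) = measure ?S {..<a}"
    using stationary_mean_snd[OF \<alpha>(1) \<alpha>1 \<sigma>(1), of \<mu> a]
    unfolding stationary_mean_def gauss_shifted_lessThan[OF \<sigma>(1)] G_def .
  have mean_G': "(\<integral>x. G' x \<partial>?S) = measure ?S {..<a}"
    using stationary_mean_snd[OF \<beta>0 \<alpha>(3) \<sigma>(2), of \<nu> a]
    unfolding stationary_mean_def gauss_shifted_lessThan[OF \<sigma>(2)] G'_def eq .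
  have "(\<integral>x. indicator {..<a} x * G x \<partial>?S) = (\<integral>x. indicator {..<a} x * G' x \<partial>?S)"
    using same unfolding stationary_mean_def integral_mult_right_zero
      gauss_shifted_lessThan[OF \<sigma>(1)] gauss_shifted_lessThan[OF \<sigma>(2)] G_def G'_def eq .
  moreover have "integrable ?S (\<lambda>x. indicator {..<a} x * G x)" "integrable ?S (\<lambda>x. indicator {..<a} x * G' x)"
    using int by (auto intro!: integrable_real_mult_indicator simp: mult.commute[of "indicator _ _"])
  ultimately have half: "(\<integral>x. indicator {..<a} x * (G' x - G x) \<partial>?S) = 0"
    by (simp add: right_diff_distrib)
  have total: "(\<integral>x. G' x - G x \<partial>?S) = 0"
    using int mean_G mean_G' by simp
  define s where "s = \<sigma> / sqrt (1 - \<alpha>\<^sup>2)"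
  have root: "0 < sqrt (1 - \<alpha>\<^sup>2)" "0 < sqrt (1 - \<beta>\<^sup>2)"
    using \<alpha> by (simp_all add: abs_square_less_1)
  have "sqrt (1 - \<beta>\<^sup>2) < sqrt (1 - \<alpha>\<^sup>2)"
    using \<alpha> by (simp add: power_strict_mono)
  moreover have s: "0 < s" "\<sigma> = s * sqrt (1 - \<alpha>\<^sup>2)" "\<tau> = s * sqrt (1 - \<beta>\<^sup>2)"
  proof -
    have ne: "sqrt (1 - \<alpha>\<^sup>2) \<noteq> 0" "sqrt (1 - \<beta>\<^sup>2) \<noteq> 0" using root by linarith+
    show "0 < s" unfolding s_def using \<sigma>(1) root(1) by (rule divide_pos_pos)
    show "\<sigma> = s * sqrt (1 - \<alpha>\<^sup>2)" unfolding s_def by (rule nonzero_divide_eq_eq[OF ne(1), THEN iffD1, OF refl])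
    show "\<tau> = s * sqrt (1 - \<beta>\<^sup>2)" unfolding s_def sd by (rule nonzero_divide_eq_eq[OF ne(2), THEN iffD1, OF refl])
  qed
  ultimately have "\<tau> < \<sigma>" by simp
  define B where "B = \<beta> / \<tau> - \<alpha> / \<sigma>"
  define A where "A = (a - \<nu>) / \<tau> - (a - \<mu>) / \<sigma>"
  define x0 where "x0 = A / B"
  have B: "0 < B"
  proof -
    have "\<alpha> / \<sigma> \<le> \<alpha> / \<tau>" using \<open>\<tau> < \<sigma>\<close> \<alpha> \<sigma> by (intro divide_left_mono) auto
    also have "\<dots> < \<beta> / \<tau>" using \<alpha> \<sigma> by (intro divide_strict_right_mono) auto
    finally show ?thesis by (simp add: B_def)
  qed
  have lin: "(a - \<beta> * x - \<nu>) / \<tau> - (a - \<alpha> * x - \<mu>) / \<sigma> = B * (x0 - x)" for x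
  proof -
    have "B * (x0 - x) = A - B * x"
      using B by (simp add: x0_def right_diff_distrib)
    then show ?thesis by (simp add: A_def B_def diff_divide_distrib left_diff_distrib)
  qed
  have pos: "0 < G' x - G x" if "x < x0" for x
  proof -
    have "0 < B * (x0 - x)" using B that by simp
    then have "(a - \<alpha> * x - \<mu>) / \<sigma> < (a - \<beta> * x - \<nu>) / \<tau>" using lin[of x] by linarith
    then show ?thesis using strict_monoD[OF strict_mono_std_normal_cdf] by (simp add: G_def G'_def)
  qed
  have neg: "G' x - G x < 0" if "x0 < x" for x
  proof -
    have "B * (x0 - x) < 0" using B that by (simp add: mult_less_0_iff)
    then have "(a - \<beta> * x - \<nu>) / \<tau> < (a - \<alpha> * x - \<mu>) / \<sigma>" using lin[of x] by linarith
    then show ?thesis using strict_monoD[OF strict_mono_std_normal_cdf] by (simp add: G_def G'_def)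
  qed
  \<comment> \<open>Subtracting \<open>\<kappa>\<close> times the total integral, which is \<open>0\<close>, treats both positions of \<open>a\<close> at once and makes the integrand nonnegative.\<close>
  define \<kappa> :: real where "\<kappa> = (if x0 < a then 1 else 0)"
  define \<phi> where "\<phi> x = indicator {..<a} x * (G' x - G x) - \<kappa> * (G' x - G x)" for x
  have int_\<phi>: "integrable ?S \<phi>" unfolding \<phi>_def using intD by auto
  have zero: "(\<integral>x. \<phi> x \<partial>?S) = 0"
    unfolding \<phi>_def using intD half total by simp
  have nonneg: "0 \<le> \<phi> x" for x
    using pos[of x] neg[of x] by (cases "x0 < a"; cases "x < a") (auto simp: \<phi>_def \<kappa>_def indicator_def)
  obtain u v where uv: "u < v" and strict: "\<And>x. x \<in> {u<..<v} \<Longrightarrow> \<phi> x \<noteq> 0"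
  proof (cases "x0 < a")
    case True
    show thesis
    proof (rule that[of a "a + 1"])
      fix x assume "x \<in> {a<..<a + 1}"
      then show "\<phi> x \<noteq> 0" using True neg[of x] by (auto simp: \<phi>_def \<kappa>_def)
    qed simp
  next
    case False
    show thesis
    proof (rule that[of "a - 1" a])
      fix x assume "x \<in> {a - 1<..<a}"
      then show "\<phi> x \<noteq> 0" using False pos[of x] by (auto simp: \<phi>_def \<kappa>_def)
    qed simp
  qed
  have "AE x in ?S. \<phi> x = 0"
    using zero nonneg integral_nonneg_eq_0_iff_AE[OF int_\<phi>] by simp
  then have "AE x in ?S. x \<notin> {u<..<v}"
    using strict by (rule_tac AE_mp) (auto intro!: AE_I2)
  then have "measure ?S {u<..<v} = 0"
    by (subst (asm) AE_iff_measurable[of "{u<..<v}"]) (auto simp: measure_def)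
  moreover have "0 < measure ?S {u<..<v}"
    unfolding stationary_def using uv
    by (intro measure_gauss_interval_pos stationary_sd_pos \<alpha> \<alpha>1 \<sigma>)
  ultimately show False by simp
qed

lemma rounding_off_le_iff: "rounding_off x \<le> k \<longleftrightarrow> x < real_of_int k + 1 / 2"
  unfolding rounding_off_eq_round round_def by linarith

text \<open>The half-lines \<open>{..<1/2}\<close> and \<open>{..<3/2}\<close> are unions of cells, so their indicators are functions of the
  roundings.\<close>

lemma rounded_pair_statistic_separates:
  assumes \<theta>: "0 \<le> \<alpha>" "\<alpha> < 1" "0 < \<sigma>" and \<theta>': "0 \<le> \<alpha>'" "\<alpha>' < 1" "0 < \<sigma>'"
    and neq: "(\<alpha>, \<mu>, \<sigma>) \<noteq> (\<alpha>', \<mu>', \<sigma>')"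
  obtains \<gamma> :: "int \<Rightarrow> int \<Rightarrow> real" where "\<And>y y'. 0 \<le> \<gamma> y y' \<and> \<gamma> y y' \<le> 1"
    "stationary_mean \<alpha> \<mu> \<sigma> (\<lambda>x x'. \<gamma> (rounding_off x) (rounding_off x')) \<noteq>
     stationary_mean \<alpha>' \<mu>' \<sigma>' (\<lambda>x x'. \<gamma> (rounding_off x) (rounding_off x'))"
proof (rule ccontr)
  assume "\<not> thesis"
  with that have same: "stationary_mean \<alpha> \<mu> \<sigma> (\<lambda>x x'. \<gamma> (rounding_off x) (rounding_off x')) =
     stationary_mean \<alpha>' \<mu>' \<sigma>' (\<lambda>x x'. \<gamma> (rounding_off x) (rounding_off x'))"
    if "\<And>y y'. 0 \<le> \<gamma> y y' \<and> \<gamma> y y' \<le> 1" for \<gamma>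
    using that by blast
  have ind: "indicator {..k} (rounding_off x) = (indicator {..<real_of_int k + 1 / 2} x :: real)" for k x
    by (simp add: indicator_def rounding_off_le_iff)
  have marg: "measure (stationary \<alpha> \<mu> \<sigma>) {..<real_of_int k + 1 / 2} = measure (stationary \<alpha>' \<mu>' \<sigma>') {..<real_of_int k + 1 / 2}" for k
  proof -
    have "stationary_mean \<alpha> \<mu> \<sigma> (\<lambda>x x'. indicator {..k} (rounding_off x')) =
        stationary_mean \<alpha>' \<mu>' \<sigma>' (\<lambda>x x'. indicator {..k} (rounding_off x'))"
      by (rule same) (simp add: indicator_def)
    then show ?thesis unfolding ind stationary_mean_snd[OF \<theta>] stationary_mean_snd[OF \<theta>'] .
  qed
  have law: "\<mu> / (1 - \<alpha>) = \<mu>' / (1 - \<alpha>') \<and> \<sigma> / sqrt (1 - \<alpha>\<^sup>2) = \<sigma>' / sqrt (1 - \<alpha>'\<^sup>2)"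
    using marg[of 0] marg[of 1] unfolding stationary_def
    by (rule gauss_eq_of_two_quantiles[OF stationary_sd_pos[OF \<theta>] stationary_sd_pos[OF \<theta>'], rotated]) simp
  then have st: "stationary \<alpha> \<mu> \<sigma> = stationary \<alpha>' \<mu>' \<sigma>'" by (simp add: stationary_def)
  have joint: "stationary_mean \<alpha> \<mu> \<sigma> (\<lambda>x y. indicator {..<real_of_int 0 + 1 / 2} x * indicator {..<real_of_int 0 + 1 / 2} y) =
      stationary_mean \<alpha>' \<mu>' \<sigma>' (\<lambda>x y. indicator {..<real_of_int 0 + 1 / 2} x * indicator {..<real_of_int 0 + 1 / 2} y)"
    unfolding ind[symmetric] by (rule same) (simp add: indicator_def)
  have "\<alpha> = \<alpha>'"
  proof (rule linorder_cases[of \<alpha> \<alpha>'])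
    assume "\<alpha> < \<alpha>'"
    from stationary_joint_cdf_neq[OF \<theta>(1) this \<theta>'(2) \<theta>(3) \<theta>'(3) st] law joint show ?thesis by blast
  next
    assume "\<alpha>' < \<alpha>"
    from stationary_joint_cdf_neq[OF \<theta>'(1) this \<theta>(2) \<theta>'(3) \<theta>(3) st[symmetric]] law joint show ?thesis by metis
  qed
  moreover from this have "\<mu> = \<mu>'" "\<sigma> = \<sigma>'"
    using law \<theta>' by (auto simp: abs_square_eq_1)
  ultimately show False using neq by simp
qed

lemma measurable_rounded_pair:
  fixes \<gamma> :: "int \<Rightarrow> int \<Rightarrow> real"
  shows "case_prod (\<lambda>x x'. \<gamma> (rounding_off x) (rounding_off x')) \<in> borel_measurable (borel \<Otimes>\<^sub>M borel)"
proof -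
  have "(\<lambda>p. \<gamma> (rounding_off (fst p)) (rounding_off (snd p))) \<in> borel_measurable (borel \<Otimes>\<^sub>M (borel :: real measure))"
    by (rule measurable_compose_countable[where f = "\<lambda>k p. \<gamma> k (rounding_off (snd p))"])
       (rule measurable_compose[where g = "\<gamma> _"], measurable)
  then show ?thesis unfolding case_prod_beta' .
qed

section \<open>Likelihood ratios along the true path\<close>

definition rounded_path :: "real \<Rightarrow> (nat \<Rightarrow> real) \<Rightarrow> nat \<Rightarrow> int" where
  "rounded_path \<alpha> e i = rounding_off (state \<alpha> e i)"

lemma rounded_path_0 [simp]: "rounded_path \<alpha> e 0 = 0"
  by (simp add: rounded_path_def rounding_off_zero)

lemma path_expect_cong:
  "(\<And>i. i < n \<Longrightarrow> f i = f' i) \<Longrightarrow> path_expect \<alpha> \<nu> f n h = path_expect \<alpha> \<nu> f' n h"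
  by (induction n arbitrary: h) simp_all

lemma rounded_prob_cong:
  assumes "\<And>i. i \<le> n \<Longrightarrow> z i = z' i"
  shows "rounded_prob \<theta> n z = rounded_prob \<theta> n z'"
  unfolding rounded_prob_def
  by (rule path_expect_cong) (use assms in \<open>simp add: cell_indicator_def fun_eq_iff\<close>)

text \<open>A countable set of representatives for the data up to index \<open>n\<close>.\<close>

definition int_paths :: "nat \<Rightarrow> (nat \<Rightarrow> int) set" where
  "int_paths n = {z. z 0 = 0 \<and> (\<forall>i>n. z i = 0)}"

lemma countable_int_paths: "countable (int_paths n)"
proof (rule countable_subset)
  let ?ext = "\<lambda>l i. if i < length l then l ! i else (0 :: int)"
  show "int_paths n \<subseteq> range ?ext"
  proof
    fix z assume "z \<in> int_paths n"
    then have "z = ?ext (map z [0..<Suc n])"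
      by (auto simp: int_paths_def fun_eq_iff simp del: upt_Suc)
    then show "z \<in> range ?ext" by blast
  qed
qed simp

text \<open>The data take countably many values, so an event about them is a countable disjoint union of the
  events whose probabilities are the likelihoods.\<close>

lemma emeasure_rounded_event:
  assumes M: "prob_space M" "iid_normal M \<mu> \<sigma> \<epsilon>" and \<sigma>: "0 < \<sigma>"
    and A: "\<And>z z'. (\<And>i. i \<le> n \<Longrightarrow> z i = z' i) \<Longrightarrow> A z \<Longrightarrow> A z'"
  shows "{\<omega> \<in> space M. A (rounded_path \<alpha> (\<lambda>i. \<epsilon> i \<omega>))} \<in> sets M" (is "?E \<in> _")
    and "emeasure M {\<omega> \<in> space M. A (rounded_path \<alpha> (\<lambda>i. \<epsilon> i \<omega>))} =
      (\<integral>\<^sup>+z. rounded_prob (\<alpha>, \<mu>, \<sigma>) n z \<partial>count_space {z \<in> int_paths n. A z})"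
proof -
  note [measurable] = iid_normal_measurable[OF M(2)]
  let ?C = "\<lambda>z. {\<omega> \<in> space M. \<forall>i<n. rounding_off (state \<alpha> (\<lambda>i. \<epsilon> i \<omega>) (Suc i)) = z (Suc i)}"
  let ?Z = "{z \<in> int_paths n. A z}"
  have C: "?C z \<in> sets M" for z by measurable
  have agree: "rounded_path \<alpha> e i = z i"
    if "z \<in> int_paths n" "\<forall>i<n. rounding_off (state \<alpha> e (Suc i)) = z (Suc i)" "i \<le> n" for z e i
    using that by (cases i) (auto simp: rounded_path_def int_paths_def rounding_off_zero simp del: state.simps(2))
  have E: "?E = (\<Union>z\<in>?Z. ?C z)"
  proof (intro equalityI subsetI)
    fix \<omega> assume \<omega>: "\<omega> \<in> ?E"
    let ?z = "\<lambda>i. if i \<le> n then rounded_path \<alpha> (\<lambda>i. \<epsilon> i \<omega>) i else 0"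
    have "A ?z" by (rule A[of "rounded_path \<alpha> (\<lambda>i. \<epsilon> i \<omega>)"]) (use \<omega> in auto)
    then have "?z \<in> ?Z" by (simp add: int_paths_def)
    moreover have "\<omega> \<in> ?C ?z" using \<omega> by (simp add: rounded_path_def del: state.simps)
    ultimately show "\<omega> \<in> (\<Union>z\<in>?Z. ?C z)" by blast
  next
    fix \<omega> assume "\<omega> \<in> (\<Union>z\<in>?Z. ?C z)"
    then obtain z where z: "z \<in> int_paths n" "A z" "\<omega> \<in> ?C z" by blast
    then have "A (rounded_path \<alpha> (\<lambda>i. \<epsilon> i \<omega>))"
      using agree[OF z(1)] by (intro A[OF _ z(2)]) simp
    then show "\<omega> \<in> ?E" using z by simp
  qed
  have cnt: "countable ?Z"
    using countable_int_paths by (rule countable_subset[rotated]) auto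
  show "?E \<in> sets M" unfolding E using C cnt by (intro sets.countable_UN'') auto
  have "disjoint_family_on ?C ?Z"
    unfolding disjoint_family_on_def
  proof (intro ballI impI equals0I)
    fix z z' \<omega> assume z: "z \<in> ?Z" "z' \<in> ?Z" "z \<noteq> z'" "\<omega> \<in> ?C z \<inter> ?C z'"
    have "z i = z' i" for i
      using agree[of z "\<lambda>i. \<epsilon> i \<omega>" i] agree[of z' "\<lambda>i. \<epsilon> i \<omega>" i] z
      by (cases "i \<le> n") (auto simp: int_paths_def simp del: state.simps)
    then show False using z(3) by auto
  qed
  then have "emeasure M ?E = (\<integral>\<^sup>+z. emeasure M (?C z) \<partial>count_space ?Z)"
    unfolding E by (intro emeasure_UN_countable C cnt)
  also have "\<dots> = (\<integral>\<^sup>+z. rounded_prob (\<alpha>, \<mu>, \<sigma>) n z \<partial>count_space ?Z)"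
    by (intro nn_integral_cong emeasure_rounded_path[OF M \<sigma>]) (auto simp: int_paths_def)
  finally show "emeasure M ?E = (\<integral>\<^sup>+z. rounded_prob (\<alpha>, \<mu>, \<sigma>) n z \<partial>count_space ?Z)" .
qed

text \<open>On \<open>B\<close> every single data sequence is at most \<open>exp v\<close> times as likely under the first parameter as
  under the second, and the probabilities of the sequences in \<open>B\<close> under the second parameter sum to at
  most that of \<open>A\<close>.\<close>

lemma likelihood_ratio_change_of_measure:
  fixes \<alpha> \<alpha>' v :: real
  assumes M: "prob_space M" and \<epsilon>: "iid_normal M \<mu> \<sigma> \<epsilon>" "0 < \<sigma>" and \<epsilon>': "iid_normal M \<mu>' \<sigma>' \<epsilon>'" "0 < \<sigma>'"
    and A: "\<And>z z'. (\<And>i. i \<le> n \<Longrightarrow> z i = z' i) \<Longrightarrow> A z \<Longrightarrow> A z'"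
  defines "B \<equiv> \<lambda>z. A z \<and> rounded_prob (\<alpha>, \<mu>, \<sigma>) n z \<le> ennreal (exp v) * rounded_prob (\<alpha>', \<mu>', \<sigma>') n z"
  shows "{\<omega> \<in> space M. B (rounded_path \<alpha> (\<lambda>i. \<epsilon> i \<omega>))} \<in> sets M"
    and "measure M {\<omega> \<in> space M. B (rounded_path \<alpha> (\<lambda>i. \<epsilon> i \<omega>))} \<le>
      exp v * measure M {\<omega> \<in> space M. A (rounded_path \<alpha>' (\<lambda>i. \<epsilon>' i \<omega>))}"
proof -
  interpret prob_space M by fact
  have B: "B z'" if "\<And>i. i \<le> n \<Longrightarrow> z i = z' i" "B z" for z z'
    using that A[of z z'] rounded_prob_cong[of n z z'] unfolding B_def by simp
  let ?Z = "{z \<in> int_paths n. B z}"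
  show "{\<omega> \<in> space M. B (rounded_path \<alpha> (\<lambda>i. \<epsilon> i \<omega>))} \<in> sets M"
    by (rule emeasure_rounded_event(1)[OF M \<epsilon>, of n]) (rule B)
  have "emeasure M {\<omega> \<in> space M. B (rounded_path \<alpha> (\<lambda>i. \<epsilon> i \<omega>))} =
      (\<integral>\<^sup>+z. rounded_prob (\<alpha>, \<mu>, \<sigma>) n z \<partial>count_space ?Z)"
    by (rule emeasure_rounded_event(2)[OF M \<epsilon>, of n]) (rule B)
  also have "\<dots> \<le> (\<integral>\<^sup>+z. ennreal (exp v) * rounded_prob (\<alpha>', \<mu>', \<sigma>') n z \<partial>count_space ?Z)"
    by (intro nn_integral_mono) (auto simp: B_def)
  also have "\<dots> = ennreal (exp v) * (\<integral>\<^sup>+z. rounded_prob (\<alpha>', \<mu>', \<sigma>') n z \<partial>count_space ?Z)"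
    by (rule nn_integral_cmult) simp
  also have "(\<integral>\<^sup>+z. rounded_prob (\<alpha>', \<mu>', \<sigma>') n z \<partial>count_space ?Z) =
      emeasure M {\<omega> \<in> space M. B (rounded_path \<alpha>' (\<lambda>i. \<epsilon>' i \<omega>))}"
    by (rule emeasure_rounded_event(2)[OF M \<epsilon>', of n, symmetric]) (rule B)
  also have "\<dots> \<le> emeasure M {\<omega> \<in> space M. A (rounded_path \<alpha>' (\<lambda>i. \<epsilon>' i \<omega>))}"
    by (rule emeasure_mono[OF _ emeasure_rounded_event(1)[OF M \<epsilon>', of n]]) (auto simp: B_def intro: A)
  finally show "measure M {\<omega> \<in> space M. B (rounded_path \<alpha> (\<lambda>i. \<epsilon> i \<omega>))} \<le>
      exp v * measure M {\<omega> \<in> space M. A (rounded_path \<alpha>' (\<lambda>i. \<epsilon>' i \<omega>))}"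
    by (simp add: emeasure_eq_measure mult_left_mono flip: ennreal_mult')
qed

lemma AE_eventually_notin_exp_small:
  assumes "prob_space M" "\<And>n. A n \<in> sets M" "0 < c" "\<And>n. measure M (A n) \<le> exp (D - c * real n)"
  shows "AE \<omega> in M. eventually (\<lambda>n. \<omega> \<notin> A n) sequentially"
proof -
  interpret prob_space M by fact
  have "summable (\<lambda>n. exp D * exp (- c) ^ n)"
    using \<open>0 < c\<close> by (intro summable_mult summable_geometric) simp
  moreover have "exp D * exp (- c) ^ n = exp (D - c * real n)" for n
    by (simp flip: exp_of_nat_mult exp_add add: mult.commute)
  ultimately have "summable (\<lambda>n. exp (D - c * real n))" by simp
  then have "summable (\<lambda>n. measure M (A n))"
    by (rule summable_comparison_test'[where N = 0]) (use assms(4) in auto)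
  then have "AE \<omega> in M. eventually (\<lambda>n. \<omega> \<in> space M - A n) sequentially"
    by (intro borel_cantelli_AE1 assms(2)) (auto simp: emeasure_eq_measure)
  then show ?thesis by (auto elim!: eventually_mono)
qed

lemma stationary_mean_complement:
  assumes \<theta>: "0 \<le> \<alpha>" "\<alpha> < 1" "0 < \<sigma>"
    and [measurable]: "case_prod g \<in> borel_measurable (borel \<Otimes>\<^sub>M borel)" and g01: "\<And>x y. 0 \<le> g x y \<and> g x y \<le> 1"
  shows "stationary_mean \<alpha> \<mu> \<sigma> (\<lambda>x y. 1 - g x y) = 1 - stationary_mean \<alpha> \<mu> \<sigma> g"
proof -
  interpret S: prob_space "stationary \<alpha> \<mu> \<sigma>" using \<theta> by (rule prob_space_stationary)
  interpret N: prob_space "gauss \<mu> \<sigma>" using \<theta>(3) by (rule prob_space_gauss)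
  have int: "integrable (gauss \<mu> \<sigma>) (\<lambda>e. g x (\<alpha> * x + e))" for x
    using g01 by (intro N.integrable_const_bound[where B = 1]) auto
  let ?P = "\<lambda>x. \<integral>e. g x (\<alpha> * x + e) \<partial>gauss \<mu> \<sigma>"
  have "0 \<le> ?P x \<and> ?P x \<le> 1" for x
    using g01 int by (auto intro!: integral_nonneg N.integral_le_const)
  then have "integrable (stationary \<alpha> \<mu> \<sigma>) ?P"
    by (intro S.integrable_const_bound[where B = 1]) auto
  then show ?thesis
    unfolding stationary_mean_def using int N.prob_space S.prob_space by simp
qed

text \<open>The primed parameter is the wrong one. The set \<open>B n\<close> collects the data for which the statistic is on
  the side typical of the true parameter and the wrong likelihood is nevertheless not exponentially
  small. By the change of measure its true probability is at most \<open>exp (\<eta> n)\<close> times a probability of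
  order \<open>exp (- c n)\<close> under the wrong parameter, which is summable for \<open>\<eta> = c / 2\<close>.\<close>

lemma likelihood_separation:
  assumes M: "prob_space M" and \<epsilon>: "iid_normal M \<mu> \<sigma> \<epsilon>" and \<epsilon>': "iid_normal M \<mu>' \<sigma>' \<epsilon>'"
    and \<theta>: "0 \<le> \<alpha>" "\<alpha> < 1" "0 < \<sigma>" and \<theta>': "0 \<le> \<alpha>'" "\<alpha>' < 1" "0 < \<sigma>'"
    and neq: "(\<alpha>, \<mu>, \<sigma>) \<noteq> (\<alpha>', \<mu>', \<sigma>')"
  obtains \<eta> where "0 < \<eta>"
    "AE \<omega> in M. eventually (\<lambda>n. rounded_prob (\<alpha>', \<mu>', \<sigma>') n (rounded_path \<alpha> (\<lambda>i. \<epsilon> i \<omega>)) <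
       ennreal (exp (- \<eta> * real n)) * rounded_prob (\<alpha>, \<mu>, \<sigma>) n (rounded_path \<alpha> (\<lambda>i. \<epsilon> i \<omega>))) sequentially"
proof -
  note [measurable] = iid_normal_measurable[OF \<epsilon>] iid_normal_measurable[OF \<epsilon>']
  let ?mean = "\<lambda>\<alpha> \<mu> \<sigma> \<gamma>. stationary_mean \<alpha> \<mu> \<sigma> (\<lambda>x x'. \<gamma> (rounding_off x) (rounding_off x'))"
  obtain \<gamma> :: "int \<Rightarrow> int \<Rightarrow> real" where \<gamma>: "\<And>y y'. 0 \<le> \<gamma> y y' \<and> \<gamma> y y' \<le> 1"
    and less: "?mean \<alpha>' \<mu>' \<sigma>' \<gamma> < ?mean \<alpha> \<mu> \<sigma> \<gamma>"
  proof -
    obtain \<gamma> :: "int \<Rightarrow> int \<Rightarrow> real" where \<gamma>: "\<And>y y'. 0 \<le> \<gamma> y y' \<and> \<gamma> y y' \<le> 1"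
      and neq: "?mean \<alpha> \<mu> \<sigma> \<gamma> \<noteq> ?mean \<alpha>' \<mu>' \<sigma>' \<gamma>"
      using rounded_pair_statistic_separates[OF \<theta> \<theta>' neq] by blast
    show thesis
    proof (cases "?mean \<alpha>' \<mu>' \<sigma>' \<gamma> < ?mean \<alpha> \<mu> \<sigma> \<gamma>")
      case True
      with \<gamma> show thesis by (rule that)
    next
      case False
      \<comment> \<open>Passing to \<open>1 - \<gamma>\<close> reverses the order of the two stationary means.\<close>
      show thesis
      proof (rule that[of "\<lambda>y y'. 1 - \<gamma> y y'"])
        show "?mean \<alpha>' \<mu>' \<sigma>' (\<lambda>y y'. 1 - \<gamma> y y') < ?mean \<alpha> \<mu> \<sigma> (\<lambda>y y'. 1 - \<gamma> y y')"
          using False neq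
          unfolding stationary_mean_complement[OF \<theta> measurable_rounded_pair[of \<gamma>] \<gamma>]
            stationary_mean_complement[OF \<theta>' measurable_rounded_pair[of \<gamma>] \<gamma>] by simp
      qed (use \<gamma> in simp)
    qed
  qed
  define \<delta> where "\<delta> = (?mean \<alpha> \<mu> \<sigma> \<gamma> - ?mean \<alpha>' \<mu>' \<sigma>' \<gamma>) / 2"
  define t where "t = (?mean \<alpha> \<mu> \<sigma> \<gamma> + ?mean \<alpha>' \<mu>' \<sigma>' \<gamma>) / 2"
  have \<delta>: "0 < \<delta>" using less by (simp add: \<delta>_def)
  have t: "?mean \<alpha>' \<mu>' \<sigma>' \<gamma> + \<delta> = t" "1 - ?mean \<alpha> \<mu> \<sigma> \<gamma> + \<delta> = 1 - t"
    by (simp_all add: t_def \<delta>_def field_simps)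
  define S where "S n z = (\<Sum>i<n. \<gamma> (z i) (z (Suc i)))" for n and z :: "nat \<Rightarrow> int"
  obtain c D where c: "0 < c" and conc: "\<forall>n. measure M {\<omega> \<in> space M. real n * (?mean \<alpha>' \<mu>' \<sigma>' \<gamma> + \<delta>) \<le>
        (\<Sum>i<n. \<gamma> (rounding_off (state \<alpha>' (\<lambda>i. \<epsilon>' i \<omega>) i)) (rounding_off (state \<alpha>' (\<lambda>i. \<epsilon>' i \<omega>) (Suc i))))} \<le> exp (D - c * real n)"
    using additive_functional_concentration[OF M \<epsilon>' \<theta>' measurable_rounded_pair[of \<gamma>] \<gamma> \<delta>] .
  have conc': "measure M {\<omega> \<in> space M. real n * t \<le> S n (rounded_path \<alpha>' (\<lambda>i. \<epsilon>' i \<omega>))} \<le> exp (D - c * real n)" for n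
    using conc[THEN spec, of n] unfolding t S_def rounded_path_def .
  have comp: "\<And>y y'. 0 \<le> 1 - \<gamma> y y' \<and> 1 - \<gamma> y y' \<le> 1" using \<gamma> by simp
  obtain c1 D1 where c1: "0 < c1" and conc1: "\<forall>n. measure M {\<omega> \<in> space M. real n * (?mean \<alpha> \<mu> \<sigma> (\<lambda>y y'. 1 - \<gamma> y y') + \<delta>) \<le>
        (\<Sum>i<n. 1 - \<gamma> (rounding_off (state \<alpha> (\<lambda>i. \<epsilon> i \<omega>) i)) (rounding_off (state \<alpha> (\<lambda>i. \<epsilon> i \<omega>) (Suc i))))} \<le> exp (D1 - c1 * real n)"
    using additive_functional_concentration[OF M \<epsilon> \<theta> measurable_rounded_pair[of "\<lambda>y y'. 1 - \<gamma> y y'"] comp \<delta>] .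
  have low_le: "measure M {\<omega> \<in> space M. S n (rounded_path \<alpha> (\<lambda>i. \<epsilon> i \<omega>)) \<le> real n * t} \<le> exp (D1 - c1 * real n)" for n
    using conc1[THEN spec, of n]
    unfolding stationary_mean_complement[OF \<theta> measurable_rounded_pair[of \<gamma>] \<gamma>] t S_def rounded_path_def
    by (simp add: sum_subtractf right_diff_distrib del: state.simps)
  have S_cong: "S n z = S n z'" if "\<And>i. i \<le> n \<Longrightarrow> z i = z' i" for n z z'
    unfolding S_def using that by (intro sum.cong) auto
  have low: "AE \<omega> in M. eventually (\<lambda>n. \<omega> \<notin> {\<omega> \<in> space M. S n (rounded_path \<alpha> (\<lambda>i. \<epsilon> i \<omega>)) \<le> real n * t}) sequentially"
  proof (rule AE_eventually_notin_exp_small[OF M _ c1 low_le])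
    show "{\<omega> \<in> space M. S n (rounded_path \<alpha> (\<lambda>i. \<epsilon> i \<omega>)) \<le> real n * t} \<in> sets M" for n
      by (rule emeasure_rounded_event(1)[OF M \<epsilon> \<theta>(3), of n]) (use S_cong in metis)
  qed
  define \<eta> where "\<eta> = c / 2"
  define B where "B n z \<longleftrightarrow> real n * t \<le> S n z \<and>
    rounded_prob (\<alpha>, \<mu>, \<sigma>) n z \<le> ennreal (exp (\<eta> * real n)) * rounded_prob (\<alpha>', \<mu>', \<sigma>') n z" for n z
  have A: "real n * t \<le> S n z'" if "\<And>i. i \<le> n \<Longrightarrow> z i = z' i" "real n * t \<le> S n z" for n z z'
    using that S_cong[of n z z'] by simp
  have bad: "AE \<omega> in M. eventually (\<lambda>n. \<omega> \<notin> {\<omega> \<in> space M. B n (rounded_path \<alpha> (\<lambda>i. \<epsilon> i \<omega>))}) sequentially"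
  proof (rule AE_eventually_notin_exp_small[OF M])
    show "{\<omega> \<in> space M. B n (rounded_path \<alpha> (\<lambda>i. \<epsilon> i \<omega>))} \<in> sets M" for n
      unfolding B_def by (rule likelihood_ratio_change_of_measure(1)[OF M \<epsilon> \<theta>(3) \<epsilon>' \<theta>'(3)]) (rule A)
    show "0 < \<eta>" using c by (simp add: \<eta>_def)
    show "measure M {\<omega> \<in> space M. B n (rounded_path \<alpha> (\<lambda>i. \<epsilon> i \<omega>))} \<le> exp (D - \<eta> * real n)" for n
    proof -
      have "measure M {\<omega> \<in> space M. B n (rounded_path \<alpha> (\<lambda>i. \<epsilon> i \<omega>))} \<le>
          exp (\<eta> * real n) * measure M {\<omega> \<in> space M. real n * t \<le> S n (rounded_path \<alpha>' (\<lambda>i. \<epsilon>' i \<omega>))}"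
        unfolding B_def by (rule likelihood_ratio_change_of_measure(2)[OF M \<epsilon> \<theta>(3) \<epsilon>' \<theta>'(3)]) (rule A)
      also have "\<dots> \<le> exp (\<eta> * real n) * exp (D - c * real n)"
        by (intro mult_left_mono conc') simp
      also have "\<dots> = exp (D - \<eta> * real n)"
        by (simp add: \<eta>_def flip: exp_add)
      finally show ?thesis .
    qed
  qed
  have "AE \<omega> in M. eventually (\<lambda>n. rounded_prob (\<alpha>', \<mu>', \<sigma>') n (rounded_path \<alpha> (\<lambda>i. \<epsilon> i \<omega>)) <
       ennreal (exp (- \<eta> * real n)) * rounded_prob (\<alpha>, \<mu>, \<sigma>) n (rounded_path \<alpha> (\<lambda>i. \<epsilon> i \<omega>))) sequentially"
    using low bad AE_space
  proof eventually_elim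
    case (elim \<omega>)
    let ?z = "rounded_path \<alpha> (\<lambda>i. \<epsilon> i \<omega>)"
    from elim(1,2) show ?case
    proof eventually_elim
      case (elim n)
      then have "\<not> rounded_prob (\<alpha>, \<mu>, \<sigma>) n ?z \<le> ennreal (exp (\<eta> * real n)) * rounded_prob (\<alpha>', \<mu>', \<sigma>') n ?z"
        using \<open>\<omega> \<in> space M\<close> by (auto simp: B_def)
      moreover have "rounded_prob (\<alpha>, \<mu>, \<sigma>) n ?z \<le> ennreal (exp (\<eta> * real n)) * rounded_prob (\<alpha>', \<mu>', \<sigma>') n ?z"
        if "ennreal (exp (- \<eta> * real n)) * rounded_prob (\<alpha>, \<mu>, \<sigma>) n ?z \<le> rounded_prob (\<alpha>', \<mu>', \<sigma>') n ?z"
      proof -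
        have "rounded_prob (\<alpha>, \<mu>, \<sigma>) n ?z =
            ennreal (exp (\<eta> * real n)) * (ennreal (exp (- \<eta> * real n)) * rounded_prob (\<alpha>, \<mu>, \<sigma>) n ?z)"
          by (simp flip: mult.assoc ennreal_mult' exp_add)
        also have "\<dots> \<le> ennreal (exp (\<eta> * real n)) * rounded_prob (\<alpha>', \<mu>', \<sigma>') n ?z"
          using that by (rule mult_left_mono) simp
        finally show ?thesis .
      qed
      ultimately show ?case by (meson not_le)
    qed
  qed
  moreover have "0 < \<eta>" using c by (simp add: \<eta>_def)
  ultimately show thesis by (rule that[rotated])
qed

lemma rounded_squares_linear_growth:
  assumes M: "prob_space M" "iid_normal M \<mu> \<sigma> \<epsilon>" and \<theta>: "0 \<le> \<alpha>" "\<alpha> < 1" "0 < \<sigma>"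
  obtains K where "0 < K"
    "AE \<omega> in M. eventually (\<lambda>n. (\<Sum>i<n. 2 + 2 * (real_of_int (rounded_path \<alpha> (\<lambda>i. \<epsilon> i \<omega>) i))\<^sup>2 +
       2 * (real_of_int (rounded_path \<alpha> (\<lambda>i. \<epsilon> i \<omega>) (Suc i)))\<^sup>2) \<le> K * real n) sequentially"
proof -
  note [measurable] = iid_normal_measurable[OF M(2)]
  obtain K where K: "\<forall>n. measure M {\<omega> \<in> space M. K * real n \<le> (\<Sum>i<n. (state \<alpha> (\<lambda>i. \<epsilon> i \<omega>) (Suc i))\<^sup>2)} \<le> exp (- real n)"
    using sum_squares_linear_growth[OF M \<theta>] .
  have "AE \<omega> in M. eventually (\<lambda>n. \<omega> \<notin> {\<omega> \<in> space M. K * real n \<le> (\<Sum>i<n. (state \<alpha> (\<lambda>i. \<epsilon> i \<omega>) (Suc i))\<^sup>2)}) sequentially"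
    by (rule AE_eventually_notin_exp_small[OF M(1), where c = 1 and D = 0]) (use K in \<open>auto simp del: state.simps\<close>)
  then have "AE \<omega> in M. eventually (\<lambda>n. (\<Sum>i<n. 2 + 2 * (real_of_int (rounded_path \<alpha> (\<lambda>i. \<epsilon> i \<omega>) i))\<^sup>2 +
       2 * (real_of_int (rounded_path \<alpha> (\<lambda>i. \<epsilon> i \<omega>) (Suc i)))\<^sup>2) \<le> (4 + 8 * \<bar>K\<bar>) * real n) sequentially"
    using AE_space
  proof eventually_elim
    case (elim \<omega>)
    define x where "x = state \<alpha> (\<lambda>i. \<epsilon> i \<omega>)"
    define z where "z i = real_of_int (rounded_path \<alpha> (\<lambda>i. \<epsilon> i \<omega>) i)" for i
    have z0: "z 0 = 0" by (simp add: z_def)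
    have zx: "(z i)\<^sup>2 \<le> 2 * (x i)\<^sup>2 + 1 / 2" for i
      using square_le_of_close[of "z i" "x i"] rounding_off_close[of "x i"]
      unfolding z_def rounded_path_def x_def[symmetric] by (simp only: abs_minus_commute)
    from elim(1) have "eventually (\<lambda>n. (\<Sum>i<n. 2 + 2 * (z i)\<^sup>2 + 2 * (z (Suc i))\<^sup>2) \<le> (4 + 8 * \<bar>K\<bar>) * real n) sequentially"
    proof eventually_elim
      case (elim n)
      have "(\<Sum>i<n. (z i)\<^sup>2) \<le> (\<Sum>i<Suc n. (z i)\<^sup>2)" by simp
      also have "\<dots> = (\<Sum>i<n. (z (Suc i))\<^sup>2)"
        unfolding sum.lessThan_Suc_shift by (simp add: z0)
      finally have shift: "(\<Sum>i<n. (z i)\<^sup>2) \<le> (\<Sum>i<n. (z (Suc i))\<^sup>2)" .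
      have "(\<Sum>i<n. (z (Suc i))\<^sup>2) \<le> (\<Sum>i<n. 2 * (x (Suc i))\<^sup>2 + 1 / 2)"
        by (intro sum_mono zx)
      also have "\<dots> = 2 * (\<Sum>i<n. (x (Suc i))\<^sup>2) + real n / 2"
        by (simp add: sum.distrib sum_distrib_left)
      finally have zsum: "(\<Sum>i<n. (z (Suc i))\<^sup>2) \<le> 2 * (\<Sum>i<n. (x (Suc i))\<^sup>2) + real n / 2" .
      have xsum: "(\<Sum>i<n. (x (Suc i))\<^sup>2) \<le> K * real n"
        using elim \<open>\<omega> \<in> space M\<close> unfolding x_def by simp
      have "K * real n \<le> \<bar>K\<bar> * real n" by (intro mult_right_mono) auto
      moreover have "(\<Sum>i<n. 2 + 2 * (z i)\<^sup>2 + 2 * (z (Suc i))\<^sup>2) =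
          2 * real n + 2 * (\<Sum>i<n. (z i)\<^sup>2) + 2 * (\<Sum>i<n. (z (Suc i))\<^sup>2)"
        by (simp add: sum.distrib sum_distrib_left)
      ultimately show ?case
        using shift zsum xsum unfolding distrib_right by linarith
    qed
    then show ?case by (simp only: z_def)
  qed
  then show thesis by (rule that[rotated]) simp
qed

text \<open>On a ball where \<open>log_density_gap\<close> is below \<open>\<eta> / K\<close>, moving the wrong parameter changes its likelihood
  by a factor of at most \<open>exp (\<eta> n)\<close>, which the exponential margin absorbs.\<close>

lemma likelihood_locally_dominated:
  assumes M: "prob_space M" and \<epsilon>: "iid_normal M \<mu> \<sigma> \<epsilon>" and \<epsilon>': "iid_normal M \<mu>' \<sigma>' \<epsilon>'"
    and \<theta>: "0 \<le> \<alpha>" "\<alpha> < 1" "0 < \<sigma>" and \<theta>': "0 \<le> \<alpha>'" "\<alpha>' < 1" "0 < \<sigma>'"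
    and neq: "(\<alpha>, \<mu>, \<sigma>) \<noteq> (\<alpha>', \<mu>', \<sigma>')"
  obtains \<rho> where "0 < \<rho>"
    "AE \<omega> in M. eventually (\<lambda>n. \<forall>\<theta>''\<in>ball (\<alpha>', \<mu>', \<sigma>') \<rho>. 0 < snd (snd \<theta>'') \<longrightarrow>
       rounded_prob \<theta>'' n (rounded_path \<alpha> (\<lambda>i. \<epsilon> i \<omega>)) < rounded_prob (\<alpha>, \<mu>, \<sigma>) n (rounded_path \<alpha> (\<lambda>i. \<epsilon> i \<omega>))) sequentially"
proof -
  obtain \<eta> where \<eta>: "0 < \<eta>" and sep:
    "AE \<omega> in M. eventually (\<lambda>n. rounded_prob (\<alpha>', \<mu>', \<sigma>') n (rounded_path \<alpha> (\<lambda>i. \<epsilon> i \<omega>)) <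
       ennreal (exp (- \<eta> * real n)) * rounded_prob (\<alpha>, \<mu>, \<sigma>) n (rounded_path \<alpha> (\<lambda>i. \<epsilon> i \<omega>))) sequentially"
    using likelihood_separation[OF M \<epsilon> \<epsilon>' \<theta> \<theta>' neq] .
  obtain K where K: "0 < K" and growth:
    "AE \<omega> in M. eventually (\<lambda>n. (\<Sum>i<n. 2 + 2 * (real_of_int (rounded_path \<alpha> (\<lambda>i. \<epsilon> i \<omega>) i))\<^sup>2 +
       2 * (real_of_int (rounded_path \<alpha> (\<lambda>i. \<epsilon> i \<omega>) (Suc i)))\<^sup>2) \<le> K * real n) sequentially"
    using rounded_squares_linear_growth[OF M \<epsilon> \<theta>] .
  let ?\<theta>' = "(\<alpha>', \<mu>', \<sigma>')"
  have "isCont (\<lambda>\<theta>''. log_density_gap \<theta>'' ?\<theta>') ?\<theta>'"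
    using \<theta>' by (intro isCont_log_density_gap) simp
  then obtain \<rho> where \<rho>: "0 < \<rho>" and close: "\<And>\<theta>''. dist \<theta>'' ?\<theta>' < \<rho> \<Longrightarrow> \<bar>log_density_gap \<theta>'' ?\<theta>'\<bar> < \<eta> / K"
    unfolding continuous_at_eps_delta dist_real_def log_density_gap_self
    using \<eta> K by (metis diff_zero divide_pos_pos)
  have "AE \<omega> in M. eventually (\<lambda>n. \<forall>\<theta>''\<in>ball ?\<theta>' \<rho>. 0 < snd (snd \<theta>'') \<longrightarrow>
       rounded_prob \<theta>'' n (rounded_path \<alpha> (\<lambda>i. \<epsilon> i \<omega>)) < rounded_prob (\<alpha>, \<mu>, \<sigma>) n (rounded_path \<alpha> (\<lambda>i. \<epsilon> i \<omega>))) sequentially"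
    using sep growth
  proof eventually_elim
    case (elim \<omega>)
    let ?z = "rounded_path \<alpha> (\<lambda>i. \<epsilon> i \<omega>)"
    from elim show ?case
    proof eventually_elim
      case (elim n)
      show ?case
      proof (intro ballI impI)
        fix \<theta>'' assume b: "\<theta>'' \<in> ball ?\<theta>' \<rho>" and pos: "0 < snd (snd \<theta>'')"
        let ?S = "\<Sum>i<n. 2 + 2 * (real_of_int (?z i))\<^sup>2 + 2 * (real_of_int (?z (Suc i)))\<^sup>2"
        have gap: "log_density_gap \<theta>'' ?\<theta>' < \<eta> / K"
          using close[of \<theta>''] b by (simp add: dist_commute)
        have "log_density_gap \<theta>'' ?\<theta>' * ?S \<le> log_density_gap \<theta>'' ?\<theta>' * (K * real n)"
          using elim(2) log_density_gap_nonneg by (rule mult_left_mono)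
        also have "\<dots> \<le> (\<eta> / K) * (K * real n)"
          using gap K by (intro mult_right_mono) auto
        also have "\<dots> = \<eta> * real n" using K by simp
        finally have "rounded_prob \<theta>'' n ?z \<le> ennreal (exp (\<eta> * real n)) * rounded_prob ?\<theta>' n ?z"
          using \<theta>' by (intro order_trans[OF rounded_prob_ratio[OF pos, of ?\<theta>']] mult_right_mono ennreal_leI) simp_all
        then have "ennreal (exp (- \<eta> * real n)) * rounded_prob \<theta>'' n ?z \<le>
            ennreal (exp (- \<eta> * real n)) * (ennreal (exp (\<eta> * real n)) * rounded_prob ?\<theta>' n ?z)"
          by (rule mult_left_mono) simp
        also have "\<dots> = rounded_prob ?\<theta>' n ?z"
          by (simp flip: mult.assoc ennreal_mult' exp_add)
        also have "\<dots> < ennreal (exp (- \<eta> * real n)) * rounded_prob (\<alpha>, \<mu>, \<sigma>) n ?z" by (rule elim(1))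
        finally show "rounded_prob \<theta>'' n ?z < rounded_prob (\<alpha>, \<mu>, \<sigma>) n ?z"
          by (meson mult_left_mono not_le zero_le)
      qed
    qed
  qed
  with \<rho> show thesis by (rule that)
qed

section \<open>Consistency\<close>

text \<open>Outside a ball around the limit the compact set is covered by finitely many avoided balls, so only
  finitely many null sets have to be united for each radius, and countably many radii suffice.\<close>

lemma AE_tendsto_of_locally_avoided:
  fixes T :: "nat \<Rightarrow> 'a \<Rightarrow> 'b::metric_space"
  assumes K: "compact K" and T: "\<And>n \<omega>. 1 \<le> n \<Longrightarrow> \<omega> \<in> space M \<Longrightarrow> T n \<omega> \<in> K"
    and avoid: "\<And>\<theta>. \<theta> \<in> K \<Longrightarrow> \<theta> \<noteq> l \<Longrightarrow>
      \<exists>\<rho>>0. AE \<omega> in M. eventually (\<lambda>n. T n \<omega> \<notin> ball \<theta> \<rho>) sequentially"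
  shows "AE \<omega> in M. (\<lambda>n. T n \<omega>) \<longlonglongrightarrow> l"
proof -
  obtain \<rho> where \<rho>: "\<And>\<theta>. \<theta> \<in> K - {l} \<Longrightarrow> 0 < \<rho> \<theta> \<and>
      (AE \<omega> in M. eventually (\<lambda>n. T n \<omega> \<notin> ball \<theta> (\<rho> \<theta>)) sequentially)"
    using avoid by (metis Diff_iff singletonI)
  have near: "AE \<omega> in M. eventually (\<lambda>n. dist (T n \<omega>) l < inverse (real (Suc k))) sequentially" for k
  proof -
    let ?r = "inverse (real (Suc k))"
    let ?C = "K - ball l ?r"
    have C: "compact ?C" using K by (rule compact_diff) simp
    have CK: "\<theta> \<in> K - {l}" if "\<theta> \<in> ?C" for \<theta>
      using that by auto
    have cover: "?C \<subseteq> (\<Union>\<theta>\<in>?C. ball \<theta> (\<rho> \<theta>))"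
    proof
      fix \<theta> assume \<theta>: "\<theta> \<in> ?C"
      then have "\<theta> \<in> ball \<theta> (\<rho> \<theta>)" using \<rho>[OF CK[OF \<theta>]] by simp
      with \<theta> show "\<theta> \<in> (\<Union>\<theta>\<in>?C. ball \<theta> (\<rho> \<theta>))" by (rule UN_I)
    qed
    obtain F where F: "F \<subseteq> ?C" "finite F" "?C \<subseteq> (\<Union>\<theta>\<in>F. ball \<theta> (\<rho> \<theta>))"
      using compactE_image[OF C open_ball cover] .
    have "AE \<omega> in M. \<forall>\<theta>\<in>F. eventually (\<lambda>n. T n \<omega> \<notin> ball \<theta> (\<rho> \<theta>)) sequentially"
    proof (rule AE_finite_allI[OF F(2)])
      fix \<theta> assume "\<theta> \<in> F"
      with F(1) have "\<theta> \<in> ?C" by (rule subsetD)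
      from \<rho>[OF CK[OF this]] show "AE \<omega> in M. eventually (\<lambda>n. T n \<omega> \<notin> ball \<theta> (\<rho> \<theta>)) sequentially" ..
    qed
    then show ?thesis
      using AE_space
    proof eventually_elim
      case (elim \<omega>)
      have "eventually (\<lambda>n. \<forall>\<theta>\<in>F. T n \<omega> \<notin> ball \<theta> (\<rho> \<theta>)) sequentially"
        using F(2) elim(1) by (rule eventually_ball_finite)
      then show ?case
        using eventually_ge_at_top[of 1]
      proof eventually_elim
        case (elim n)
        then have "T n \<omega> \<notin> ?C" using F(3) by blast
        then show ?case
          using T[OF elim(2) \<open>\<omega> \<in> space M\<close>] by (simp add: dist_commute)
      qed
    qed
  qed
  have "AE \<omega> in M. \<forall>k. eventually (\<lambda>n. dist (T n \<omega>) l < inverse (real (Suc k))) sequentially"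
    unfolding AE_all_countable using near by blast
  then show ?thesis
  proof eventually_elim
    case (elim \<omega>)
    show ?case
    proof (rule tendstoI)
      fix e :: real assume "0 < e"
      then obtain k where k: "inverse (real (Suc k)) < e" using reals_Archimedean by blast
      show "eventually (\<lambda>n. dist (T n \<omega>) l < e) sequentially"
        using elim[rule_format, of k] by (rule eventually_mono) (use k in linarith)
    qed
  qed
qed

lemma log_likelihood_eq:
  assumes M: "prob_space M" "iid_normal M \<mu> \<sigma> (E (\<alpha>, \<mu>, \<sigma>))" and \<sigma>: "0 < \<sigma>"
    and y: "\<And>i. y i = z (Suc i)" and z: "z 0 = 0"
  obtains p where "0 \<le> p" "rounded_prob (\<alpha>, \<mu>, \<sigma>) (Suc n) z = ennreal p"
    "log_likelihood M E n (\<alpha>, \<mu>, \<sigma>) y = ln p"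
proof
  interpret prob_space M by fact
  let ?A = "{\<omega> \<in> space M. \<forall>i\<le>n. rounded_ar1 \<alpha> (E (\<alpha>, \<mu>, \<sigma>)) i \<omega> = y i}"
  show "0 \<le> measure M ?A" by simp
  have "?A = {\<omega> \<in> space M. \<forall>i<Suc n. rounding_off (state \<alpha> (\<lambda>i. E (\<alpha>, \<mu>, \<sigma>) i \<omega>) (Suc i)) = z (Suc i)}"
    by (simp add: rounded_ar1_def ar1_eq_state y less_Suc_eq_le del: state.simps)
  then show "rounded_prob (\<alpha>, \<mu>, \<sigma>) (Suc n) z = ennreal (measure M ?A)"
    using emeasure_rounded_path[where z = z and \<epsilon> = "E (\<alpha>, \<mu>, \<sigma>)", OF M \<sigma> z, of "Suc n" \<alpha>] by (simp only: emeasure_eq_measure)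
  show "log_likelihood M E n (\<alpha>, \<mu>, \<sigma>) y = ln (measure M ?A)"
    by (simp add: log_likelihood_def)
qed

theorem theorem3p1:
  fixes M :: "'a measure"
    and \<alpha>_lo \<alpha>_hi \<mu>_lo \<mu>_hi \<sigma>_lo \<sigma>_hi :: real
    and \<Theta> :: "param set"
    and \<alpha>_star \<mu>_star \<sigma>_star :: real
    and \<epsilon> :: "nat \<Rightarrow> 'a \<Rightarrow> real"
    and E :: "param \<Rightarrow> nat \<Rightarrow> 'a \<Rightarrow> real"
    and Y :: "nat \<Rightarrow> 'a \<Rightarrow> int"
    and T :: "nat \<Rightarrow> 'a \<Rightarrow> param"
  assumes "prob_space M"
    and "{\<alpha>_lo..\<alpha>_hi} \<subseteq> {0..<1}"
    and "{\<sigma>_lo..\<sigma>_hi} \<subseteq> {0<..}"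
    and "\<Theta> = {\<alpha>_lo..\<alpha>_hi} \<times> {\<mu>_lo..\<mu>_hi} \<times> {\<sigma>_lo..\<sigma>_hi}"
    and "(\<alpha>_star, \<mu>_star, \<sigma>_star) \<in> \<Theta>"
    and "iid_normal M \<mu>_star \<sigma>_star \<epsilon>"
    and "\<And>n \<omega>. Y n \<omega> = rounded_ar1 \<alpha>_star \<epsilon> n \<omega>"
    and "\<And>\<alpha> \<mu> \<sigma>. (\<alpha>, \<mu>, \<sigma>) \<in> \<Theta> \<Longrightarrow> iid_normal M \<mu> \<sigma> (E (\<alpha>, \<mu>, \<sigma>))"
    and "\<And>n. n \<ge> 1 \<Longrightarrow> T n \<in> borel_measurable M"
    and "\<And>n \<omega>. n \<ge> 1 \<Longrightarrow> \<omega> \<in> space M \<Longrightarrow>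
           is_arg_max (\<lambda>\<theta>. log_likelihood M E n \<theta> (\<lambda>i. Y i \<omega>)) (\<lambda>\<theta>. \<theta> \<in> \<Theta>) (T n \<omega>)"
  shows "AE \<omega> in M. (\<lambda>n. T n \<omega>) \<longlonglongrightarrow> (\<alpha>_star, \<mu>_star, \<sigma>_star)"
proof (rule AE_tendsto_of_locally_avoided)
  note M = assms(1) and \<epsilon> = assms(6) and Y = assms(7) and E = assms(8) and argmax = assms(10)
  show "compact \<Theta>"
    unfolding assms(4) by (intro compact_Times compact_Icc)
  show in_\<Theta>: "T n \<omega> \<in> \<Theta>" if "1 \<le> n" "\<omega> \<in> space M" for n \<omega>
    using argmax[OF that] by (simp add: is_arg_max_def)
  have range: "0 \<le> \<alpha>" "\<alpha> < 1" "0 < \<sigma>" if "(\<alpha>, \<mu>, \<sigma>) \<in> \<Theta>" for \<alpha> \<mu> \<sigma>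
    using that assms(2,3) unfolding assms(4) by auto
  let ?star = "(\<alpha>_star, \<mu>_star, \<sigma>_star)"
  let ?z = "\<lambda>\<omega>. rounded_path \<alpha>_star (\<lambda>i. \<epsilon> i \<omega>)"
  have Yz: "Y i \<omega> = ?z \<omega> (Suc i)" for i \<omega>
    by (simp add: Y rounded_ar1_def ar1_eq_state rounded_path_def del: state.simps)
  have argmax_ge: "rounded_prob ?star (Suc n) (?z \<omega>) \<le> rounded_prob (T n \<omega>) (Suc n) (?z \<omega>)"
    if n: "1 \<le> n" and \<omega>: "\<omega> \<in> space M" for n \<omega>
  proof (rule ccontr)
    assume "\<not> ?thesis"
    then have less: "rounded_prob (T n \<omega>) (Suc n) (?z \<omega>) < rounded_prob ?star (Suc n) (?z \<omega>)" by simp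
    obtain \<alpha> \<mu> \<sigma> where t: "T n \<omega> = (\<alpha>, \<mu>, \<sigma>)" by (rule prod_cases3)
    have \<theta>: "(\<alpha>, \<mu>, \<sigma>) \<in> \<Theta>" using in_\<Theta>[OF n \<omega>] by (simp add: t)
    obtain p where p: "0 \<le> p" "rounded_prob (\<alpha>, \<mu>, \<sigma>) (Suc n) (?z \<omega>) = ennreal p"
      "log_likelihood M E n (\<alpha>, \<mu>, \<sigma>) (\<lambda>i. Y i \<omega>) = ln p"
      using log_likelihood_eq[where E = E and y = "\<lambda>i. Y i \<omega>" and z = "?z \<omega>" and n = n, OF M E[OF \<theta>] range(3)[OF \<theta>] Yz rounded_path_0] .
    obtain q where q: "0 \<le> q" "rounded_prob ?star (Suc n) (?z \<omega>) = ennreal q"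
      "log_likelihood M E n ?star (\<lambda>i. Y i \<omega>) = ln q"
      using log_likelihood_eq[where E = E and y = "\<lambda>i. Y i \<omega>" and z = "?z \<omega>" and n = n, OF M E[OF assms(5)] range(3)[OF assms(5)] Yz rounded_path_0] .
    have pq: "p < q" using less p q by (simp add: t ennreal_less_iff)
    \<comment> \<open>The logarithm is monotone on positive numbers only, so \<open>p = 0\<close> must be excluded; it would force \<open>q = 0\<close>.\<close>
    have "p \<noteq> 0"
      using rounded_prob_ratio[of ?star "(\<alpha>, \<mu>, \<sigma>)" "Suc n" "?z \<omega>"] range(3)[OF \<theta>] range(3)[OF assms(5)] p q pq
      by (auto simp: ennreal_eq_0_iff)
    then have "ln p < ln q" using p(1) pq by simp
    moreover have "\<not> log_likelihood M E n (T n \<omega>) (\<lambda>i. Y i \<omega>) < log_likelihood M E n ?star (\<lambda>i. Y i \<omega>)"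
      using argmax[OF n \<omega>] assms(5) unfolding is_arg_max_def by blast
    ultimately show False
      unfolding t p(3) q(3) by simp
  qed
  fix \<theta> assume \<theta>: "\<theta> \<in> \<Theta>" "\<theta> \<noteq> ?star"
  obtain \<alpha> \<mu> \<sigma> where t: "\<theta> = (\<alpha>, \<mu>, \<sigma>)" by (rule prod_cases3)
  note \<theta>' = \<theta>[unfolded t]
  obtain \<rho> where \<rho>: "0 < \<rho>" and dom: "AE \<omega> in M. eventually (\<lambda>n. \<forall>\<theta>''\<in>ball \<theta> \<rho>. 0 < snd (snd \<theta>'') \<longrightarrow>
       rounded_prob \<theta>'' n (?z \<omega>) < rounded_prob ?star n (?z \<omega>)) sequentially"
    using likelihood_locally_dominated[OF M \<epsilon> E[OF \<theta>'(1)] range[OF assms(5)] range[OF \<theta>'(1)] \<theta>'(2)[symmetric]]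
    unfolding t .
  have "AE \<omega> in M. eventually (\<lambda>n. T n \<omega> \<notin> ball \<theta> \<rho>) sequentially"
    using dom AE_space
  proof eventually_elim
    case (elim \<omega>)
    \<comment> \<open>The estimate with index \<open>n\<close> uses the \<open>n + 1\<close> observations with indices \<open>0, \<dots>, n\<close>.\<close>
    have "eventually (\<lambda>n. \<forall>\<theta>''\<in>ball \<theta> \<rho>. 0 < snd (snd \<theta>'') \<longrightarrow>
       rounded_prob \<theta>'' (Suc n) (?z \<omega>) < rounded_prob ?star (Suc n) (?z \<omega>)) sequentially"
      using elim(1) by (subst eventually_sequentially_Suc)
    then show ?case
      using eventually_ge_at_top[of 1]
    proof eventually_elim
      case (elim n)
      have "0 < snd (snd (T n \<omega>))"
        using in_\<Theta>[OF elim(2) \<open>\<omega> \<in> space M\<close>] range(3) by (cases "T n \<omega>") auto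
      then show ?case
        using elim(1) argmax_ge[OF elim(2) \<open>\<omega> \<in> space M\<close>] by (meson not_le)
    qed
  qed
  with \<rho> show "\<exists>\<rho>>0. AE \<omega> in M. eventually (\<lambda>n. T n \<omega> \<notin> ball \<theta> \<rho>) sequentially" by blast
qed

end
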